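(* Let $(E,d)$ be a Polish metric space, let $x_0\in E$, let $\mu\in\mathcal P(E)$ satisfy an $\alpha(\mathcal T_d)$ inequality, and let $L_n=\frac1n\sum_{i=1}^n\delta_{X_i}$ where $X_1,\dots,X_n$ are i.i.d. with law $\mu$. Let $t>0$. Let $a>0$ be such that $E_{a,1}=\int e^{a\,d(x_0,x)}\,\mu(dx)\le 2$. Choose a compact set $K\subset E$ with $x_0\in K$ and $$\mu(K^c)\le\left[\frac{32}{at}\log\frac{32}{at}-\frac{32}{at}+1\right]^{-1}.$$ Let $\mathcal F_K$ be the set of $1$-Lipschitz functions $f:K\to\mathbb R$ with $f(x_0)=0$, endowed with the uniform distance, and let $\mathcal C_t=\mathcal N(\mathcal F_K,t/8)$ be its covering number of order $t/8$. Then $$\mathbb P\big(W_1(L_n,\mu)\ge t\big)\le\exp\left(-n\,\alpha\left[\frac t2-\Gamma(\mathcal C_t,n)\right]\right),$$ where $$\Gamma(\mathcal C_t,n)=\inf_{\lambda>0}\frac1\lambda\Big[\log\mathcal C_t+n\,\alpha^\circledast\big(\tfrac{\lambda}{n}\big)\Big],$$ with the convention that $\alpha(x)=0$ for $x<0$.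
   Context: $\mathcal P(E)$ is the set of Borel probability measures on $E$. $W_1(\mu,\nu)=\inf_\pi\int d(x,y)\,\pi(dx,dy)$, the infimum running over probability measures $\pi$ on $E\times E$ with marginals $\mu,\nu$. The relative entropy is $H(\nu|\mu)=\int\log\frac{d\nu}{d\mu}\,d\nu$ if $\nu\ll\mu$ and $+\infty$ otherwise. $\alpha:[0,+\infty)\to\mathbb R$ denotes a convex, increasing, left-continuous function with $\alpha(0)=0$. $\mu$ satisfies an $\alpha(\mathcal T_d)$ inequality if $\alpha(W_1(\mu,\nu))\le H(\nu|\mu)$ for all $\nu\in\mathcal P(E)$. The monotone conjugate is $\alpha^\circledast(s)=\sup_{t\ge0}\,(st-\alpha(t))$. For a totally bounded metric space $A$ and $\delta>0$, the covering number $\mathcal N(A,\delta)$ is the minimal number of (closed) balls of radius $\delta$, centered in $A$, needed to cover $A$. If the bracket in the condition on $\mu(K^c)$ vanishes, its inverse is read as $+\infty$. *)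

theory Defs
  imports "HOL-Probability.Probability"
begin

abbreviation borel_probs :: "'a::topological_space measure set"
  where "borel_probs \<equiv> space (prob_algebra borel)"

definition couplings ::
    "'a::polish_space measure \<Rightarrow> 'a measure \<Rightarrow> ('a \<times> 'a) measure set"
  where "couplings \<mu> \<nu> =
    {\<pi> \<in> borel_probs. distr \<pi> borel fst = \<mu> \<and> distr \<pi> borel snd = \<nu>}"

definition W1 :: "'a::polish_space measure \<Rightarrow> 'a measure \<Rightarrow> ennreal"
  where "W1 \<mu> \<nu> = (INF \<pi>\<in>couplings \<mu> \<nu>. \<integral>\<^sup>+ z. ennreal (dist (fst z) (snd z)) \<partial>\<pi>)"

(* H(\<nu>|\<mu>).  Since u log u is bounded below, the negative part of log (d\<nu>/d\<mu>) is always
   \<nu>-integrable; so if \<nu> << \<mu> and log (d\<nu>/d\<mu>) is not \<nu>-integrable, its integral is +\<infinity>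
   (whereas the Bochner integral underlying KL_divergence would return 0). *)
definition rel_entropy :: "'a measure \<Rightarrow> 'a measure \<Rightarrow> ereal"
  where "rel_entropy \<nu> \<mu> =
    (if absolutely_continuous \<mu> \<nu> \<and> integrable \<nu> (entropy_density (exp 1) \<mu> \<nu>)
     then ereal (KL_divergence (exp 1) \<mu> \<nu>) else \<infinity>)"

(* A function \<alpha> on [0,\<infinity>) extended by 0 to negative arguments (including -\<infinity>), and by its
   supremum, which is its limit when \<alpha> is nondecreasing, to +\<infinity>. *)
definition extend :: "(real \<Rightarrow> real) \<Rightarrow> ereal \<Rightarrow> ereal"
  where "extend \<alpha> x =
    (if x < 0 then 0
     else if x = \<infinity> then (SUP t\<in>{0..}. ereal (\<alpha> t))
     else ereal (\<alpha> (real_of_ereal x)))"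

definition transport_ineq :: "(real \<Rightarrow> real) \<Rightarrow> 'a::polish_space measure \<Rightarrow> bool"
  where "transport_ineq \<alpha> \<mu> \<longleftrightarrow>
    (\<forall>\<nu>\<in>borel_probs. extend \<alpha> (enn2ereal (W1 \<mu> \<nu>)) \<le> rel_entropy \<nu> \<mu>)"

definition mono_conj :: "(real \<Rightarrow> real) \<Rightarrow> real \<Rightarrow> ereal"
  where "mono_conj \<alpha> s = (SUP t\<in>{0..}. ereal (s * t - \<alpha> t))"

(* Meaningful when A is totally bounded for d; otherwise the LEAST may be unspecified. *)
definition covering_number :: "'b set \<Rightarrow> ('b \<Rightarrow> 'b \<Rightarrow> real) \<Rightarrow> real \<Rightarrow> nat"
  where "covering_number A d \<delta> =
    (LEAST k. \<exists>C. C \<subseteq> A \<and> finite C \<and> card C = k \<and> A \<subseteq> (\<Union>c\<in>C. {x \<in> A. d c x \<le> \<delta>}))"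

(* Functions on K are represented by functions on the whole type that are undefined off K. *)
definition lip_functions :: "'a::metric_space set \<Rightarrow> 'a \<Rightarrow> ('a \<Rightarrow> real) set"
  where "lip_functions K x\<^sub>0 = {f \<in> extensional K. 1-lipschitz_on K f \<and> f x\<^sub>0 = 0}"

definition uniform_dist :: "'a set \<Rightarrow> ('a \<Rightarrow> real) \<Rightarrow> ('a \<Rightarrow> real) \<Rightarrow> real"
  where "uniform_dist K f g = (SUP x\<in>K. \<bar>f x - g x\<bar>)"

definition empirical_measure :: "nat \<Rightarrow> (nat \<Rightarrow> 'a::topological_space) \<Rightarrow> 'a measure"
  where "empirical_measure n x =
    measure_of UNIV (sets borel)
      (\<lambda>A. ennreal (1 / real n) * (\<Sum>i\<in>{1..n}. emeasure (return borel (x i)) A))"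

definition Gamma_term :: "(real \<Rightarrow> real) \<Rightarrow> nat \<Rightarrow> nat \<Rightarrow> ereal"
  where "Gamma_term \<alpha> C n =
    (INF l\<in>{0<..}. ereal (1 / l) * (ereal (ln (real C)) + ereal (real n) * mono_conj \<alpha> (l / real n)))"

end

theory Submission
  imports Defs
begin

text \<open>Testing the transport inequality against the Gibbs measures \<open>e\<^sup>\<lambda>\<^sup>f \<mu> / Z\<close> bounds the
  Laplace transform of every centred 1-Lipschitz function by \<open>exp (\<alpha>\<^sup>\<circledast>(\<lambda>))\<close>. Integrating out one coordinate
  at a time carries this bound over to functions on \<open>E\<^sup>n\<close> that are 1-Lipschitz for the sum metric,
  hence to \<open>F(x) = sup (\<integral>f dL\<^sub>n - \<integral>f d\<mu>)\<close>, the supremum running over all 1-Lipschitz \<open>f\<close>. Chernoff's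
  bound at a subgradient of \<open>\<alpha>\<close> gives \<open>P(F \<ge> E F + s) \<le> exp (- n \<alpha>(s))\<close>. Replacing \<open>f\<close> by the nearest
  centre of a \<open>t/8\<close>-covering of \<open>F\<^sub>K\<close> costs \<open>t/4\<close> on \<open>K\<close> and, by Young's inequality, at most \<open>t/4\<close> in
  expectation off \<open>K\<close>, so that \<open>E F \<le> t/2 + \<Gamma>\<close>. Since \<open>L\<^sub>n\<close> is finitely supported, the duality
  \<open>W\<^sub>1(L\<^sub>n, \<mu>) \<le> F\<close> only involves couplings of the form \<open>\<Sum>\<^sub>i \<delta>\<^bsub>x\<^sub>i\<^esub> \<otimes> p\<^sub>i \<mu>\<close> with a measurable partition of
  unity \<open>(p\<^sub>i)\<close>, and follows from the first-order condition for minimising the cost with a penalty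
  on the masses of the \<open>p\<^sub>i \<mu>\<close>.\<close>

section \<open>Laplace transform of Lipschitz functions\<close>

lemma lipschitz_1D: "1-lipschitz_on UNIV f \<Longrightarrow> \<bar>f x - f y\<bar> \<le> dist x y" for f :: "'a::metric_space \<Rightarrow> real"
  using lipschitz_onD[of 1 UNIV f x y] by (simp add: dist_real_def)

lemma lipschitz_1I: "(\<And>x y. f x - f y \<le> dist x y) \<Longrightarrow> 1-lipschitz_on UNIV f" for f :: "'a::metric_space \<Rightarrow> real"
  by (rule lipschitz_onI) (auto simp: dist_real_def abs_le_iff, metis dist_commute)

lemma lipschitz_1_measurable [measurable_dest]: "1-lipschitz_on UNIV f \<Longrightarrow> f \<in> borel_measurable borel" for f :: "'a::metric_space \<Rightarrow> real"
  by (intro borel_measurable_continuous_onI lipschitz_on_continuous_on)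

lemma lipschitz_1_truncate:
  fixes f :: "'a::metric_space \<Rightarrow> real"
  assumes "1-lipschitz_on UNIV f"
  shows "1-lipschitz_on UNIV (\<lambda>x. max (- m) (min m (f x)))"
proof (rule lipschitz_1I)
  fix x y show "max (- m) (min m (f x)) - max (- m) (min m (f y)) \<le> dist x y"
    using lipschitz_1D[OF assms, of x y] by (auto simp: max_def min_def)
qed

text \<open>The easy half of Kantorovich duality: under any coupling the difference of means is the
  expectation of a difference dominated by the distance. Boundedness of \<open>f\<close> makes it
  integrable under \<nu>, of which no first moment is known.\<close>

lemma integral_diff_le_W1:
  fixes \<mu> \<nu> :: "'a::polish_space measure"
  assumes lip: "1-lipschitz_on UNIV f" and bdd: "\<And>x. \<bar>f x\<bar> \<le> B"
  shows "ennreal ((\<integral>x. f x \<partial>\<nu>) - (\<integral>x. f x \<partial>\<mu>)) \<le> W1 \<mu> \<nu>"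
  unfolding W1_def
proof (rule INF_greatest)
  fix \<pi> assume "\<pi> \<in> couplings \<mu> \<nu>"
  then have p: "prob_space \<pi>" and s: "sets \<pi> = sets borel"
    and m: "distr \<pi> borel fst = \<mu>" "distr \<pi> borel snd = \<nu>"
    by (auto simp: couplings_def space_prob_algebra)
  interpret prob_space \<pi> by fact
  note [measurable] = lipschitz_1_measurable[OF lip]
  have [measurable_cong]: "sets \<pi> = sets (borel \<Otimes>\<^sub>M (borel :: 'a measure))"
    unfolding s borel_prod ..
  have int: "integrable \<pi> (\<lambda>z. f (fst z))" "integrable \<pi> (\<lambda>z. f (snd z))"
    by (auto intro!: integrable_const_bound[where B=B] simp: bdd)
  have "ennreal ((\<integral>x. f x \<partial>\<nu>) - (\<integral>x. f x \<partial>\<mu>)) = ennreal (\<integral>z. f (snd z) - f (fst z) \<partial>\<pi>)"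
    unfolding m[symmetric] using int by (simp add: integral_distr)
  also have "\<dots> \<le> ennreal (\<integral>z. \<bar>f (snd z) - f (fst z)\<bar> \<partial>\<pi>)"
    using int by (intro ennreal_leI integral_mono) auto
  also have "\<dots> = (\<integral>\<^sup>+z. ennreal \<bar>f (snd z) - f (fst z)\<bar> \<partial>\<pi>)"
    using int by (intro nn_integral_eq_integral[symmetric]) auto
  also have "\<dots> \<le> (\<integral>\<^sup>+z. ennreal (dist (fst z) (snd z)) \<partial>\<pi>)"
    using lipschitz_1D[OF lip] by (intro nn_integral_mono ennreal_leI) (subst dist_commute, simp)
  finally show "ennreal ((\<integral>x. f x \<partial>\<nu>) - (\<integral>x. f x \<partial>\<mu>)) \<le> (\<integral>\<^sup>+z. ennreal (dist (fst z) (snd z)) \<partial>\<pi>)" .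
qed

text \<open>The Radon-Nikodym derivative is almost surely \<open>exp (g x)\<close>, so the entropy
  density is \<open>g\<close>; integrability of \<open>g\<close> under the tilted measure selects
  the finite branch of \<open>rel_entropy\<close>.\<close>

lemma rel_entropy_density_exp:
  fixes \<mu> :: "'a measure"
  assumes "prob_space \<mu>" and [measurable]: "g \<in> borel_measurable \<mu>"
    and prob: "prob_space (density \<mu> (\<lambda>x. ennreal (exp (g x))))"
    and int: "integrable (density \<mu> (\<lambda>x. ennreal (exp (g x)))) g"
  shows "rel_entropy (density \<mu> (\<lambda>x. ennreal (exp (g x)))) \<mu>
    = ereal (\<integral>x. g x \<partial>density \<mu> (\<lambda>x. ennreal (exp (g x))))"
proof -
  interpret prob_space \<mu> by fact
  let ?\<nu> = "density \<mu> (\<lambda>x. ennreal (exp (g x)))"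
  have ac: "absolutely_continuous \<mu> ?\<nu>"
    by (rule absolutely_continuousI_density) simp
  have "AE x in \<mu>. ennreal (exp (g x)) = RN_deriv \<mu> ?\<nu> x"
    by (rule RN_deriv_unique) simp_all
  then have "AE x in \<mu>. RN_deriv \<mu> ?\<nu> x = ennreal (exp (g x))"
    by eventually_elim simp
  then have "AE x in ?\<nu>. RN_deriv \<mu> ?\<nu> x = ennreal (exp (g x))"
    by (simp add: AE_density)
  then have ae: "AE x in ?\<nu>. entropy_density (exp 1) \<mu> ?\<nu> x = g x"
    by eventually_elim (simp add: entropy_density_def log_def)
  have [measurable]: "entropy_density (exp 1) \<mu> ?\<nu> \<in> borel_measurable \<mu>"
    unfolding entropy_density_def comp_def by measurable
  have "integrable ?\<nu> (entropy_density (exp 1) \<mu> ?\<nu>)"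
    using int ae by (subst integrable_cong_AE[where g=g]) auto
  moreover have "KL_divergence (exp 1) \<mu> ?\<nu> = (\<integral>x. g x \<partial>?\<nu>)"
    unfolding KL_divergence_def using ae by (intro integral_cong_AE) auto
  ultimately show ?thesis using ac by (simp add: rel_entropy_def)
qed

text \<open>The Gibbs measure with density \<open>exp (l * f x) / Z\<close> has entropy
  \<open>l\<close> times its mean of \<open>f\<close>, minus \<open>ln Z\<close>. The transport
  inequality bounds \<alpha> of the difference of means by this entropy, and
  \<open>l * w - \<alpha> w \<le> c\<close> eliminates the unknown mean. Letting \<open>c\<close> be
  any real bound of the conjugate at \<open>l\<close> avoids extended reals.\<close>

lemma transport_laplace_bounded:
  fixes \<mu> :: "'a::polish_space measure"
  assumes \<mu>: "\<mu> \<in> borel_probs" and tr: "transport_ineq \<alpha> \<mu>" and mono: "mono_on {0..} \<alpha>"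
    and lip: "1-lipschitz_on UNIV f" and bdd: "\<And>x. \<bar>f x\<bar> \<le> B"
    and l: "l \<ge> 0" and c: "\<And>u. u \<ge> 0 \<Longrightarrow> l * u - \<alpha> u \<le> c"
  shows "(\<integral>x. exp (l * f x) \<partial>\<mu>) \<le> exp (c + l * (\<integral>x. f x \<partial>\<mu>))"
proof -
  have p: "prob_space \<mu>" and s[measurable_cong]: "sets \<mu> = sets borel" 
    using \<mu> by (auto simp: space_prob_algebra)
  interpret prob_space \<mu> by fact
  note [measurable] = lipschitz_1_measurable[OF lip]
  have lb: "\<bar>l * f x\<bar> \<le> l * B" for x using bdd[of x] l by (simp add: abs_mult mult_left_mono)
  define Z where "Z = (\<integral>x. exp (l * f x) \<partial>\<mu>)"
  have int: "integrable \<mu> (\<lambda>x. exp (l * f x))"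
    using lb by (intro integrable_const_bound[where B="exp (l * B)"]) (auto simp: abs_le_iff)
  have "exp (- (l * B)) \<le> Z"
    unfolding Z_def using lb by (intro integral_ge_const[OF int]) (auto simp: abs_le_iff minus_le_iff)
  then have Z: "Z > 0" by (meson exp_gt_zero less_le_trans)
  define g where "g x = l * f x - ln Z" for x
  have [measurable]: "g \<in> borel_measurable borel" unfolding g_def by simp
  have eg: "exp (g x) = exp (l * f x) / Z" for x using Z by (simp add: g_def exp_diff)
  define \<nu> where "\<nu> = density \<mu> (\<lambda>x. ennreal (exp (g x)))"
  have "(\<integral>\<^sup>+x. ennreal (exp (g x)) \<partial>\<mu>) = ennreal (\<integral>x. exp (g x) \<partial>\<mu>)"
    using int by (intro nn_integral_eq_integral) (use Z in \<open>auto simp: eg\<close>)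
  also have "\<dots> = 1" using Z by (simp add: eg Z_def)
  finally have "prob_space \<nu>" unfolding \<nu>_def
    by (intro prob_spaceI) (simp add: emeasure_density cong: nn_integral_cong)
  then interpret \<nu>: prob_space \<nu> .
  have s\<nu>[measurable_cong]: "sets \<nu> = sets borel" by (simp add: \<nu>_def s)
  have f\<nu>: "integrable \<nu> f" by (rule \<nu>.integrable_const_bound[where B=B]) (auto simp: bdd)
  have g\<nu>: "integrable \<nu> g" unfolding g_def using f\<nu> by auto
  have H: "rel_entropy \<nu> \<mu> = ereal (\<integral>x. g x \<partial>\<nu>)"
    unfolding \<nu>_def by (rule rel_entropy_density_exp)
      (use g\<nu> \<open>prob_space \<nu>\<close> p in \<open>auto simp: \<nu>_def\<close>)
  have Ig: "(\<integral>x. g x \<partial>\<nu>) = l * (\<integral>x. f x \<partial>\<nu>) - ln Z"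
    unfolding g_def using f\<nu> by (simp add: \<nu>.prob_space)
  \<comment> \<open>The positive part keeps the argument of \<alpha> in the half-line where
    monotonicity is available; as \<open>l \<ge> 0\<close>, it can only enlarge the linear
    term.\<close>
  define w where "w = max 0 ((\<integral>x. f x \<partial>\<nu>) - (\<integral>x. f x \<partial>\<mu>))"
  have "ennreal w \<le> W1 \<mu> \<nu>"
    using integral_diff_le_W1[OF lip bdd, of \<nu> \<mu>] by (auto simp: w_def max_def ennreal_neg)
  moreover have "\<nu> \<in> borel_probs" using \<open>prob_space \<nu>\<close> s\<nu> by (simp add: space_prob_algebra)
  then have "extend \<alpha> (enn2ereal (W1 \<mu> \<nu>)) \<le> rel_entropy \<nu> \<mu>"
    using tr by (auto simp: transport_ineq_def)
  \<comment> \<open>\<open>W1 \<mu> \<nu>\<close> may be infinite; \<open>extend\<close> then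
    returns the supremum of \<alpha>, which still dominates \<open>\<alpha> w\<close>.\<close>
  moreover have "ereal (\<alpha> w) \<le> extend \<alpha> (enn2ereal W)" if "ennreal w \<le> W" for W
  proof (cases W)
    case (real r)
    then have "w \<le> r" using that by (simp add: w_def)
    then show ?thesis using real mono by (auto simp: extend_def w_def mono_on_def)
  next
    case top
    then show ?thesis by (auto simp: extend_def w_def intro!: SUP_upper)
  qed
  ultimately have "\<alpha> w \<le> l * (\<integral>x. f x \<partial>\<nu>) - ln Z"
    unfolding H Ig by (metis ereal_less_eq(3) order_trans)
  moreover have "l * w - \<alpha> w \<le> c" by (rule c) (simp add: w_def)
  moreover have "l * ((\<integral>x. f x \<partial>\<nu>) - (\<integral>x. f x \<partial>\<mu>)) \<le> l * w"
    using l by (intro mult_left_mono) (auto simp: w_def)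
  ultimately have "ln Z \<le> c + l * (\<integral>x. f x \<partial>\<mu>)" by (simp add: algebra_simps)
  then have "exp (ln Z) \<le> exp (c + l * (\<integral>x. f x \<partial>\<mu>))" by simp
  then show ?thesis using Z unfolding Z_def by (simp only: exp_ln)
qed

text \<open>Truncate at \<open>- m\<close> and \<open>m\<close>, apply the bounded case and let
  \<open>m\<close> grow: Fatou's lemma treats the exponentials, dominated convergence the means. The
  left side is a nonnegative integral because its finiteness is part of the conclusion.\<close>

lemma transport_laplace:
  fixes \<mu> :: "'a::polish_space measure"
  assumes \<mu>: "\<mu> \<in> borel_probs" and tr: "transport_ineq \<alpha> \<mu>" and mono: "mono_on {0..} \<alpha>"
    and lip: "1-lipschitz_on UNIV f" and int: "integrable \<mu> f"
    and l: "l \<ge> 0" and c: "\<And>u. u \<ge> 0 \<Longrightarrow> l * u - \<alpha> u \<le> c"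
  shows "(\<integral>\<^sup>+x. ennreal (exp (l * f x)) \<partial>\<mu>) \<le> ennreal (exp (c + l * (\<integral>x. f x \<partial>\<mu>)))"
proof -
  have p: "prob_space \<mu>" and s[measurable_cong]: "sets \<mu> = sets borel" 
    using \<mu> by (auto simp: space_prob_algebra)
  interpret prob_space \<mu> by fact
  note [measurable] = lipschitz_1_measurable[OF lip]
  define h where "h m x = max (- real m) (min (real m) (f x))" for m :: nat and x
  have [measurable]: "h m \<in> borel_measurable borel" for m unfolding h_def by simp
  have hl: "1-lipschitz_on UNIV (h m)" for m
    unfolding h_def[abs_def] by (rule lipschitz_1_truncate[OF lip])
  have hb: "\<bar>h m x\<bar> \<le> real m" for m x by (auto simp: h_def)
  have hlim: "(\<lambda>m. h m x) \<longlonglongrightarrow> f x" for x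
  proof (rule tendsto_eventually)
    obtain N where "\<bar>f x\<bar> \<le> real N" using real_arch_simple by blast
    then show "\<forall>\<^sub>F m in sequentially. h m x = f x"
      by (intro eventually_sequentiallyI[of N]) (auto simp: h_def)
  qed
  have Ilim: "(\<lambda>m. \<integral>x. h m x \<partial>\<mu>) \<longlonglongrightarrow> (\<integral>x. f x \<partial>\<mu>)"
    by (rule integral_dominated_convergence[where w="\<lambda>x. \<bar>f x\<bar>"])
      (use int hlim in \<open>auto simp: h_def\<close>)
  have "(\<integral>\<^sup>+x. ennreal (exp (l * f x)) \<partial>\<mu>) = (\<integral>\<^sup>+x. liminf (\<lambda>m. ennreal (exp (l * h m x))) \<partial>\<mu>)"
  proof (rule nn_integral_cong)
    fix x
    have "(\<lambda>m. ennreal (exp (l * h m x))) \<longlonglongrightarrow> ennreal (exp (l * f x))"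
      by (intro tendsto_intros hlim)
    then show "ennreal (exp (l * f x)) = liminf (\<lambda>m. ennreal (exp (l * h m x)))"
      by (metis lim_imp_Liminf trivial_limit_sequentially)
  qed
  also have "\<dots> \<le> liminf (\<lambda>m. \<integral>\<^sup>+x. ennreal (exp (l * h m x)) \<partial>\<mu>)"
    by (rule nn_integral_liminf) simp
  also have "\<dots> \<le> liminf (\<lambda>m. ennreal (exp (c + l * (\<integral>x. h m x \<partial>\<mu>))))"
  proof (rule Liminf_mono, rule always_eventually, rule allI)
    fix m
    have "integrable \<mu> (\<lambda>x. exp (l * h m x))"
      using hb[of m] l by (intro integrable_const_bound[where B="exp (l * real m)"])
        (auto simp: abs_le_iff mult_left_mono)
    then have "(\<integral>\<^sup>+x. ennreal (exp (l * h m x)) \<partial>\<mu>) = ennreal (\<integral>x. exp (l * h m x) \<partial>\<mu>)"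
      by (intro nn_integral_eq_integral) auto
    also have "\<dots> \<le> ennreal (exp (c + l * (\<integral>x. h m x \<partial>\<mu>)))"
      by (intro ennreal_leI transport_laplace_bounded[OF \<mu> tr mono hl hb l c])
    finally show "(\<integral>\<^sup>+x. ennreal (exp (l * h m x)) \<partial>\<mu>) \<le> ennreal (exp (c + l * (\<integral>x. h m x \<partial>\<mu>)))" .
  qed
  also have "\<dots> = ennreal (exp (c + l * (\<integral>x. f x \<partial>\<mu>)))"
    by (intro lim_imp_Liminf tendsto_intros Ilim) simp
  finally show ?thesis .
qed

section \<open>Tensorisation\<close>

text \<open>Since the points range over all functions on the index type, such an \<open>F\<close>
  ignores the coordinates outside \<open>I\<close>: points agreeing on \<open>I\<close> are at
  distance 0.\<close>

definition sum_lipschitz :: "'i set \<Rightarrow> (('i \<Rightarrow> 'a::metric_space) \<Rightarrow> real) \<Rightarrow> bool"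
  where "sum_lipschitz I F \<longleftrightarrow> (\<forall>x y. \<bar>F x - F y\<bar> \<le> (\<Sum>i\<in>I. dist (x i) (y i)))"

lemma sum_lipschitzD: "sum_lipschitz I F \<Longrightarrow> \<bar>F x - F y\<bar> \<le> (\<Sum>i\<in>I. dist (x i) (y i))"
  by (simp add: sum_lipschitz_def)

lemma sum_lipschitzI:
  assumes "\<And>x y. F x - F y \<le> (\<Sum>i\<in>I. dist (x i) (y i))"
  shows "sum_lipschitz I F"
proof -
  have "\<bar>F x - F y\<bar> \<le> (\<Sum>i\<in>I. dist (x i) (y i))" for x y
    using assms[of x y] assms[of y x] by (auto simp: abs_le_iff dist_commute)
  then show ?thesis by (simp add: sum_lipschitz_def)
qed

text \<open>Needed because the dual functional is a supremum over an uncountable family. By the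
  Lipschitz property \<open>F\<close> is the infimum of the functions
  \<open>F z + (\<Sum>i\<in>I. dist (x i) (z i))\<close>, and letting \<open>z\<close> range over a
  countable dense set suffices.\<close>

lemma borel_measurable_sum_lipschitz:
  fixes F :: "('i \<Rightarrow> 'a::{metric_space, second_countable_topology}) \<Rightarrow> real"
  assumes I: "finite I" and F: "sum_lipschitz I F"
  shows "F \<in> borel_measurable (PiM I (\<lambda>_. borel))"
proof -
  obtain D :: "'a set" where D: "countable D" "\<And>U. open U \<Longrightarrow> U \<noteq> {} \<Longrightarrow> \<exists>d\<in>D. d \<in> U"
    by (rule countable_dense_setE) blast
  define S where "S = PiE I (\<lambda>_. D)"
  have S: "countable S" unfolding S_def by (intro countable_PiE I D)
  define h where "h z x = F z + (\<Sum>i\<in>I. dist (x i) (z i))" for z x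
  have ge: "F x \<le> h z x" for x z
    using sum_lipschitzD[OF F, of x z] by (simp add: h_def)
  have "F x = (INF z\<in>S. h z x)" for x
  proof (rule antisym)
    obtain d where "d \<in> D" using D(2)[of UNIV] by auto
    then have "(\<lambda>i\<in>I. d) \<in> S" by (auto simp: S_def)
    then show "F x \<le> (INF z\<in>S. h z x)" by (intro cINF_greatest ge) auto
    show "(INF z\<in>S. h z x) \<le> F x"
    proof (rule field_le_epsilon)
      fix e :: real assume e: "e > 0"
      \<comment> \<open>The factor 2 is there because the distance from \<open>x\<close> to
        \<open>z\<close> is paid twice: in the penalty and in \<open>F z - F x\<close>. Adding 1
        keeps the denominator positive for empty \<open>I\<close>.\<close>
      define e' where "e' = e / (2 * (real (card I) + 1))"
      have e': "e' > 0" using e by (simp add: e'_def)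
      have "\<exists>d\<in>D. dist (x i) d < e'" for i
        using D(2)[of "ball (x i) e'"] e' by auto
      then obtain d where d: "\<And>i. d i \<in> D" "\<And>i. dist (x i) (d i) < e'" by metis
      define z where "z = restrict d I"
      have zS: "z \<in> S" using d by (auto simp: S_def z_def)
      have "(\<Sum>i\<in>I. dist (x i) (z i)) \<le> (\<Sum>i\<in>I. e')"
        by (intro sum_mono) (use d(2) in \<open>auto simp: z_def less_imp_le\<close>)
      also have "\<dots> \<le> e / 2" using e by (simp add: e'_def field_simps)
      finally have le: "(\<Sum>i\<in>I. dist (x i) (z i)) \<le> e / 2" .
      have "(INF z\<in>S. h z x) \<le> h z x"
        by (intro cINF_lower zS bdd_belowI2[where m="F x"] ge)
      also have "\<dots> \<le> F x + e"
        using le sum_lipschitzD[OF F, of x z] by (simp add: h_def)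
      finally show "(INF z\<in>S. h z x) \<le> F x + e" .
    qed
  qed
  moreover have "h z \<in> borel_measurable (PiM I (\<lambda>_. borel))" for z
    unfolding h_def by measurable
  ultimately have "F = (\<lambda>x. INF z\<in>S. h z x)" by auto
  moreover have "\<dots> \<in> borel_measurable (PiM I (\<lambda>_. borel))"
    using S \<open>\<And>z. h z \<in> _\<close> by (intro borel_measurable_cINF_real)
  ultimately show ?thesis by simp
qed

section \<open>Powers of a law with finite first moment\<close>

locale borel_prob_first_moment = prob_space \<mu>
  for \<mu> :: "'a::polish_space measure" +
  fixes x\<^sub>0 :: 'a
  assumes sets_mu [measurable_cong, simp]: "sets \<mu> = sets borel"
    and integrable_dist0: "integrable \<mu> (\<lambda>x. dist x x\<^sub>0)"
begin

lemma space_mu [simp]: "space \<mu> = UNIV"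
  using sets_eq_imp_space_eq[OF sets_mu] by simp

lemma prob_UNIV [simp]: "prob UNIV = 1"
  using prob_space by simp

sublocale P: product_prob_space "\<lambda>_. \<mu>" I for I :: "'i set"
  by unfold_locales

lemma sets_PiM_mu [measurable_cong]: "sets (PiM I (\<lambda>_. \<mu>)) = sets (PiM I (\<lambda>_. borel))"
  by (intro sets_PiM_cong) auto

lemma integrable_lipschitz:
  fixes f :: "'a \<Rightarrow> real"
  assumes "1-lipschitz_on UNIV f" shows "integrable \<mu> f"
proof (rule Bochner_Integration.integrable_bound[where f="\<lambda>x. \<bar>f x\<^sub>0\<bar> + dist x x\<^sub>0"])
  show "integrable \<mu> (\<lambda>x. \<bar>f x\<^sub>0\<bar> + dist x x\<^sub>0)" using integrable_dist0 by simp
  show "f \<in> borel_measurable \<mu>" using lipschitz_1_measurable[OF assms] by simp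
  show "AE x in \<mu>. norm (f x) \<le> norm (\<bar>f x\<^sub>0\<bar> + dist x x\<^sub>0)"
  proof (rule AE_I2)
    fix x show "norm (f x) \<le> norm (\<bar>f x\<^sub>0\<bar> + dist x x\<^sub>0)"
      using lipschitz_1D[OF assms, of x x\<^sub>0] by simp
  qed
qed

lemma integrable_dist: "integrable \<mu> (\<lambda>x. dist y x)"
  by (rule integrable_lipschitz, rule lipschitz_1I)
    (metis abs_dist_diff_le abs_le_D1 dist_commute)

lemma PiM_component_integral:
  fixes f :: "'a \<Rightarrow> real"
  assumes "i \<in> I" and [measurable]: "f \<in> borel_measurable borel"
  shows "(\<integral>x. f (x i) \<partial>PiM I (\<lambda>_. \<mu>)) = (\<integral>y. f y \<partial>\<mu>)"
    and "integrable (PiM I (\<lambda>_. \<mu>)) (\<lambda>x. f (x i)) \<longleftrightarrow> integrable \<mu> f"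
proof -
  have d: "distr (PiM I (\<lambda>_. \<mu>)) \<mu> (\<lambda>x. x i) = \<mu>"
    by (rule distr_PiM_component) (use assms in \<open>auto intro: prob_space_axioms\<close>)
  have [measurable]: "(\<lambda>x. x i) \<in> measurable (PiM I (\<lambda>_. \<mu>)) \<mu>"
    using assms by (intro measurable_component_singleton)
  have "(\<integral>y. f y \<partial>\<mu>) = (\<integral>y. f y \<partial>distr (PiM I (\<lambda>_. \<mu>)) \<mu> (\<lambda>x. x i))"
    by (simp only: d)
  also have "\<dots> = (\<integral>x. f (x i) \<partial>PiM I (\<lambda>_. \<mu>))"
    by (rule integral_distr) auto
  finally show "(\<integral>x. f (x i) \<partial>PiM I (\<lambda>_. \<mu>)) = (\<integral>y. f y \<partial>\<mu>)" ..
  have "integrable \<mu> f \<longleftrightarrow> integrable (distr (PiM I (\<lambda>_. \<mu>)) \<mu> (\<lambda>x. x i)) f"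
    by (simp only: d)
  also have "\<dots> \<longleftrightarrow> integrable (PiM I (\<lambda>_. \<mu>)) (\<lambda>x. f (x i))"
    by (rule integrable_distr_eq) auto
  finally show "integrable (PiM I (\<lambda>_. \<mu>)) (\<lambda>x. f (x i)) \<longleftrightarrow> integrable \<mu> f" ..
qed

lemma integrable_sum_lipschitz:
  assumes I: "finite I" and F: "sum_lipschitz I F"
  shows "integrable (PiM I (\<lambda>_. \<mu>)) F"
proof (rule Bochner_Integration.integrable_bound
    [where f="\<lambda>x. \<bar>F (\<lambda>_. x\<^sub>0)\<bar> + (\<Sum>i\<in>I. dist (x i) x\<^sub>0)"])
  have "integrable (PiM I (\<lambda>_. \<mu>)) (\<lambda>x. dist (x i) x\<^sub>0)" if "i \<in> I" for i
    using PiM_component_integral(2)[OF that, of "\<lambda>x. dist x x\<^sub>0"] integrable_dist0 by simp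
  then show "integrable (PiM I (\<lambda>_. \<mu>)) (\<lambda>x. \<bar>F (\<lambda>_. x\<^sub>0)\<bar> + (\<Sum>i\<in>I. dist (x i) x\<^sub>0))"
    by (intro Bochner_Integration.integrable_add P.integrable_const Bochner_Integration.integrable_sum)
  show "F \<in> borel_measurable (PiM I (\<lambda>_. \<mu>))"
    using borel_measurable_sum_lipschitz[OF assms] by measurable
  show "AE x in PiM I (\<lambda>_. \<mu>). norm (F x) \<le> norm (\<bar>F (\<lambda>_. x\<^sub>0)\<bar> + (\<Sum>i\<in>I. dist (x i) x\<^sub>0))"
  proof (rule AE_I2)
    fix x show "norm (F x) \<le> norm (\<bar>F (\<lambda>_. x\<^sub>0)\<bar> + (\<Sum>i\<in>I. dist (x i) x\<^sub>0))"
      using sum_lipschitzD[OF F, of x "\<lambda>_. x\<^sub>0"] sum_nonneg[of I "\<lambda>i. dist (x i) x\<^sub>0"] by simp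
  qed
qed

text \<open>Induction on \<open>I\<close>: with the other coordinates frozen, \<open>F\<close> is
  1-Lipschitz in the new one, so \<open>L\<close> applies and costs a factor \<open>exp c\<close>.
  What remains is the partial mean \<open>G\<close>, which is again sum-Lipschitz and has the same
  total mean by Fubini's theorem.\<close>

lemma laplace_tensor:
  assumes I: "finite I" and F: "sum_lipschitz I F"
    and L: "\<And>f. 1-lipschitz_on UNIV f \<Longrightarrow>
      (\<integral>\<^sup>+x. ennreal (exp (l * f x)) \<partial>\<mu>) \<le> ennreal (exp (c + l * (\<integral>x. f x \<partial>\<mu>)))"
  shows "(\<integral>\<^sup>+x. ennreal (exp (l * F x)) \<partial>PiM I (\<lambda>_. \<mu>))
    \<le> ennreal (exp (real (card I) * c + l * (\<integral>x. F x \<partial>PiM I (\<lambda>_. \<mu>))))"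
  using I F
proof (induction I arbitrary: F rule: finite_induct)
  case empty
  \<comment> \<open>Over an empty index set the sum of distances is 0, hence \<open>F\<close> is
    constant.\<close>
  have "F = (\<lambda>_. F (\<lambda>_. x\<^sub>0))" using sum_lipschitzD[OF empty] by fastforce
  then obtain b where b: "F = (\<lambda>_. b)" by blast

  show ?case unfolding b by (simp add: PiM_empty nn_integral_count_space_finite lebesgue_integral_count_space_finite)
next
  case (insert i I)
  note F = \<open>sum_lipschitz (insert i I) F\<close>
  have [measurable]: "F \<in> borel_measurable (PiM (insert i I) (\<lambda>_. \<mu>))"
    using borel_measurable_sum_lipschitz[OF finite.insertI[OF insert.hyps(1)] F] by measurable
  have int: "integrable (PiM (insert i I) (\<lambda>_. \<mu>)) F"
    using insert by (intro integrable_sum_lipschitz) auto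
  define G where "G x = (\<integral>y. F (x(i := y)) \<partial>\<mu>)" for x
  have lip: "1-lipschitz_on UNIV (\<lambda>y. F (x(i := y)))" for x
  proof (rule lipschitz_1I)
    fix y z
    have "(\<Sum>j\<in>insert i I. dist ((x(i := y)) j) ((x(i := z)) j)) = dist y z"
      using insert.hyps by (auto simp: sum.insert_remove intro!: sum.neutral)
    then show "F (x(i := y)) - F (x(i := z)) \<le> dist y z"
      using sum_lipschitzD[OF F, of "x(i := y)" "x(i := z)"] by simp
  qed
  have G: "sum_lipschitz I G"
  proof (rule sum_lipschitzI)
    fix x x'
    have "G x - G x' = (\<integral>y. F (x(i := y)) - F (x'(i := y)) \<partial>\<mu>)"
      unfolding G_def by (simp add: integrable_lipschitz[OF lip])
    also have "\<dots> \<le> (\<integral>y. (\<Sum>j\<in>I. dist (x j) (x' j)) \<partial>\<mu>)"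
    proof (rule integral_mono)
      fix y
      have "(\<Sum>j\<in>insert i I. dist ((x(i := y)) j) ((x'(i := y)) j)) = (\<Sum>j\<in>I. dist (x j) (x' j))"
        using insert.hyps by (auto intro!: sum.cong)
      then show "F (x(i := y)) - F (x'(i := y)) \<le> (\<Sum>j\<in>I. dist (x j) (x' j))"
        using sum_lipschitzD[OF F, of "x(i := y)" "x'(i := y)"] by simp
    qed (auto simp: integrable_lipschitz[OF lip])
    finally show "G x - G x' \<le> (\<Sum>j\<in>I. dist (x j) (x' j))" by (simp add: prob_space)
  qed
  note [measurable] = borel_measurable_sum_lipschitz[OF insert.hyps(1) G]
  have "(\<integral>\<^sup>+x. ennreal (exp (l * F x)) \<partial>PiM (insert i I) (\<lambda>_. \<mu>))
      = (\<integral>\<^sup>+x. \<integral>\<^sup>+y. ennreal (exp (l * F (x(i := y)))) \<partial>\<mu> \<partial>PiM I (\<lambda>_. \<mu>))"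
    by (rule P.product_nn_integral_insert) (use insert in auto)
  also have "\<dots> \<le> (\<integral>\<^sup>+x. ennreal (exp (c + l * G x)) \<partial>PiM I (\<lambda>_. \<mu>))"
    unfolding G_def by (intro nn_integral_mono L lip)
  also have "\<dots> = ennreal (exp c) * (\<integral>\<^sup>+x. ennreal (exp (l * G x)) \<partial>PiM I (\<lambda>_. \<mu>))"
    by (subst nn_integral_cmult[symmetric]) (simp_all add: exp_add ennreal_mult)
  also have "\<dots> \<le> ennreal (exp c) *
      ennreal (exp (real (card I) * c + l * (\<integral>x. G x \<partial>PiM I (\<lambda>_. \<mu>))))"
    by (intro mult_left_mono insert.IH G) auto
  also have "(\<integral>x. G x \<partial>PiM I (\<lambda>_. \<mu>)) = (\<integral>x. F x \<partial>PiM (insert i I) (\<lambda>_. \<mu>))"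
    unfolding G_def by (rule P.product_integral_insert[symmetric]) (use insert int in auto)
  finally show ?case
    using insert.hyps by (simp add: ennreal_mult[symmetric] exp_add[symmetric] algebra_simps)
qed

end

section \<open>Semi-discrete Kantorovich duality\<close>

text \<open>\<open>p i y\<close> is to be read as the conditional probability that mass at
  \<open>y\<close> is matched with the \<open>i\<close>-th atom, so these families encode the
  couplings of \<mu> with a measure on finitely many atoms.\<close>

definition measurable_partitions :: "'i set \<Rightarrow> ('i \<Rightarrow> 'a::topological_space \<Rightarrow> real) set"
  where "measurable_partitions I =
    {p. (\<forall>i\<in>I. p i \<in> borel_measurable borel \<and> (\<forall>y. 0 \<le> p i y)) \<and> (\<forall>y. (\<Sum>i\<in>I. p i y) = 1)}"

lemma measurable_partitions_le_1:
  assumes "p \<in> measurable_partitions I" "finite I" "i \<in> I"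
  shows "p i y \<le> 1"
proof -
  have "p i y \<le> (\<Sum>i\<in>I. p i y)"
    using assms by (intro member_le_sum) (auto simp: measurable_partitions_def)
  then show ?thesis using assms by (simp add: measurable_partitions_def)
qed

lemma measurable_partitions_convex:
  assumes "p \<in> measurable_partitions I" "q \<in> measurable_partitions I" "0 \<le> u" "u \<le> 1"
  shows "(\<lambda>i y. (1 - u) * p i y + u * q i y) \<in> measurable_partitions I"
  using assms unfolding measurable_partitions_def
  by (auto simp: sum.distrib sum_distrib_left[symmetric]
      intro!: borel_measurable_add borel_measurable_times)

text \<open>All weight goes to the minimising indices. Ties are split equally, which keeps the
  weights measurable without selecting an index; at least one minimiser exists because
  \<open>I\<close> is finite and nonempty.\<close>

lemma argmin_partition:
  fixes g :: "'i \<Rightarrow> 'a::topological_space \<Rightarrow> real"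
  assumes I: "finite I" "I \<noteq> {}" and g[measurable]: "\<And>i. i \<in> I \<Longrightarrow> g i \<in> borel_measurable borel"
  obtains q where "q \<in> measurable_partitions I" "\<And>y. (\<Sum>i\<in>I. q i y * g i y) = Min ((\<lambda>i. g i y) ` I)"
proof -
  define m where "m y = Min ((\<lambda>i. g i y) ` I)" for y
  define k :: "'i \<Rightarrow> 'a \<Rightarrow> real" where "k i y = (if \<forall>j\<in>I. g i y \<le> g j y then 1 else 0)" for i y
  define s where "s y = (\<Sum>i\<in>I. k i y)" for y
  define q where "q i y = k i y / s y" for i y
  have km: "k i y * g i y = k i y * m y" if "i \<in> I" for i y
    using I that by (auto simp: k_def m_def intro!: Min_eqI[symmetric])
  have s: "s y > 0" for y
  proof -
    have "m y \<in> (\<lambda>i. g i y) ` I" unfolding m_def using I by (intro Min_in) auto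
    then obtain i where i: "i \<in> I" "m y = g i y" by auto
    then have "k i y = 1" using I by (auto simp: k_def m_def Min_le simp flip: i(2))
    moreover have "k i y \<le> s y" unfolding s_def using i I by (intro member_le_sum) (auto simp: k_def)
    ultimately show ?thesis by simp
  qed
  have [measurable]: "k i \<in> borel_measurable borel" if "i \<in> I" for i
  proof -
    note [measurable] = g[OF that]
    have [measurable]: "(\<lambda>y. \<forall>j\<in>I. g i y \<le> g j y) \<in> measurable borel (count_space UNIV)"
      using I by measurable
    show ?thesis unfolding k_def by measurable
  qed
  have "q i \<in> borel_measurable borel" if "i \<in> I" for i
    using that unfolding q_def s_def by measurable
  moreover have "(\<Sum>i\<in>I. q i y) = 1" for y
    using s[of y] by (simp add: q_def sum_divide_distrib[symmetric] s_def)
  ultimately have "q \<in> measurable_partitions I"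
    using s by (auto simp: measurable_partitions_def q_def k_def less_imp_le)
  moreover have "(\<Sum>i\<in>I. q i y * g i y) = m y" for y
  proof -
    have "(\<Sum>i\<in>I. q i y * g i y) = (\<Sum>i\<in>I. q i y * m y)"
      using km by (intro sum.cong) (auto simp: q_def)
    also have "\<dots> = m y" using \<open>(\<Sum>i\<in>I. q i y) = 1\<close> by (simp add: sum_distrib_right[symmetric])
    finally show ?thesis .
  qed
  ultimately show ?thesis using that unfolding m_def by blast
qed

section \<open>Transport costs of partitions of unity\<close>

locale semidiscrete = borel_prob_first_moment \<mu> x\<^sub>0
  for \<mu> :: "'a::polish_space measure" and x\<^sub>0 :: 'a +
  fixes n :: nat and x :: "nat \<Rightarrow> 'a"
  assumes n: "n \<ge> 1"
begin

declare One_nat_def [simp del]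

abbreviation (input) I where "I \<equiv> {1..n}"
abbreviation (input) Parts where "Parts \<equiv> measurable_partitions {1..n} :: (nat \<Rightarrow> 'a \<Rightarrow> real) set"

text \<open>A partition \<open>p\<close> stands for the measure that puts the part
  \<open>p i\<close> of \<mu> opposite the atom \<open>x i\<close>. Its second marginal is always
  \<mu>; \<open>mass p\<close> lists the weights of its first marginal and \<open>cost p\<close> is
  its transport cost.\<close>

definition mass :: "(nat \<Rightarrow> 'a \<Rightarrow> real) \<Rightarrow> nat \<Rightarrow> real"
  where "mass p i = (\<integral>y. p i y \<partial>\<mu>)"

definition cost :: "(nat \<Rightarrow> 'a \<Rightarrow> real) \<Rightarrow> real"
  where "cost p = (\<Sum>i\<in>I. \<integral>y. p i y * dist (x i) y \<partial>\<mu>)"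

lemma Parts_measurable [measurable_dest]: "p \<in> Parts \<Longrightarrow> i \<in> I \<Longrightarrow> p i \<in> borel_measurable borel"
  by (simp add: measurable_partitions_def)

lemma Parts_nonneg: "p \<in> Parts \<Longrightarrow> i \<in> I \<Longrightarrow> 0 \<le> p i y"
  by (simp add: measurable_partitions_def)

lemma Parts_sum: "p \<in> Parts \<Longrightarrow> (\<Sum>i\<in>I. p i y) = 1"
  by (simp add: measurable_partitions_def)

lemma Parts_le_1: "p \<in> Parts \<Longrightarrow> i \<in> I \<Longrightarrow> p i y \<le> 1"
  by (rule measurable_partitions_le_1) auto

lemma integrable_part: 
  assumes "p \<in> Parts" "i \<in> I" shows "integrable \<mu> (p i)"
  using assms by (intro integrable_const_bound[where B=1])
    (simp_all add: Parts_nonneg Parts_le_1 Parts_measurable)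

lemma integrable_part_dist:
  assumes "p \<in> Parts" "i \<in> I" shows "integrable \<mu> (\<lambda>y. p i y * dist (x i) y)"
proof (rule Bochner_Integration.integrable_bound[where f="\<lambda>y. dist (x i) y"])
  show "integrable \<mu> (dist (x i))" by (rule integrable_dist)
  note [measurable] = Parts_measurable[OF assms]
  show "(\<lambda>y. p i y * dist (x i) y) \<in> borel_measurable \<mu>" by measurable
qed (use assms in \<open>auto simp: abs_mult Parts_nonneg Parts_le_1 mult_left_le_one_le\<close>)

lemma mass_nonneg: "p \<in> Parts \<Longrightarrow> i \<in> I \<Longrightarrow> 0 \<le> mass p i"
  unfolding mass_def by (simp add: Parts_nonneg)

lemma mass_le_1: "p \<in> Parts \<Longrightarrow> i \<in> I \<Longrightarrow> mass p i \<le> 1"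
  unfolding mass_def using integral_le_const[OF integrable_part, of p i 1] by (simp add: Parts_le_1)

lemma mass_sum: "p \<in> Parts \<Longrightarrow> (\<Sum>i\<in>I. mass p i) = 1"
  unfolding mass_def
  by (subst Bochner_Integration.integral_sum[symmetric]) (simp_all add: integrable_part Parts_sum prob_space del: Bochner_Integration.integral_sum)

lemma cost_nonneg: "p \<in> Parts \<Longrightarrow> 0 \<le> cost p"
  unfolding cost_def by (intro sum_nonneg integral_nonneg_AE) (simp add: Parts_nonneg)

lemma mass_convex:
  "p \<in> Parts \<Longrightarrow> q \<in> Parts \<Longrightarrow> i \<in> I \<Longrightarrow>
    mass (\<lambda>i y. (1 - u) * p i y + u * q i y) i = (1 - u) * mass p i + u * mass q i"
  unfolding mass_def by (simp add: integrable_part)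

text \<open>Together with \<open>mass_convex\<close> this makes the penalised cost a quadratic
  polynomial along segments of partitions.\<close>

lemma cost_convex:
  assumes "p \<in> Parts" "q \<in> Parts"
  shows "cost (\<lambda>i y. (1 - u) * p i y + u * q i y) = (1 - u) * cost p + u * cost q"
proof -
  have "(\<integral>y. ((1 - u) * p i y + u * q i y) * dist (x i) y \<partial>\<mu>)
      = (1 - u) * (\<integral>y. p i y * dist (x i) y \<partial>\<mu>) + u * (\<integral>y. q i y * dist (x i) y \<partial>\<mu>)" if "i \<in> I" for i
    using integrable_part_dist[OF assms(1) that] integrable_part_dist[OF assms(2) that]
    by (simp add: distrib_right mult.assoc)
  then show ?thesis by (simp add: cost_def sum.distrib sum_distrib_left)
qed

text \<open>The coupling is the image, under \<open>(i, y)\<close> mapped to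
  \<open>(x i, y)\<close>, of the measure with density \<open>p\<close> on the product of the
  indices and \<mu>. Working with indices rather than atoms allows coinciding sample points.\<close>

lemma W1_le_cost:
  assumes p: "p \<in> Parts" and m: "\<And>i. i \<in> I \<Longrightarrow> mass p i = 1 / real n"
  shows "W1 (empirical_measure n x) \<mu> \<le> ennreal (cost p)"
proof -
  define N where "N = count_space I \<Otimes>\<^sub>M \<mu>"
  define g where "g z = ennreal (p (fst z) (snd z))" for z
  define T where "T z = (x (fst z), snd z)" for z :: "nat \<times> 'a"
  define \<pi> :: "('a \<times> 'a) measure" where "\<pi> = distr (density N g) borel T"
  note pm[measurable] = Parts_measurable[OF p]
  have g[measurable]: "g \<in> borel_measurable N"
    unfolding N_def g_def by (rule measurable_pair_measure_countable1) auto
  have "T \<in> measurable N (borel \<Otimes>\<^sub>M (borel :: 'a measure))"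
    unfolding N_def by (rule measurable_pair_measure_countable1) (auto simp: T_def)
  then have T[measurable]: "T \<in> measurable N borel" unfolding borel_prod .
  have s: "sets \<pi> = sets borel" by (simp add: \<pi>_def)
  \<comment> \<open>This formula reduces both marginals, the total mass and the cost to finite sums
    of integrals over \<mu>.\<close>
  have int: "(\<integral>\<^sup>+z. h z \<partial>\<pi>) = (\<Sum>i\<in>I. \<integral>\<^sup>+y. ennreal (p i y) * h (x i, y) \<partial>\<mu>)"
    if [measurable]: "h \<in> borel_measurable borel" for h
  proof -
    have "(\<integral>\<^sup>+z. h z \<partial>\<pi>) = (\<integral>\<^sup>+z. g z * h (T z) \<partial>N)"
      unfolding \<pi>_def by (subst nn_integral_distr) (simp_all add: nn_integral_density)
    also have "\<dots> = (\<integral>\<^sup>+i. \<integral>\<^sup>+y. g (i, y) * h (T (i, y)) \<partial>\<mu> \<partial>count_space I)"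
    proof -
      have "(\<lambda>z. g z * h (T z)) \<in> borel_measurable (count_space I \<Otimes>\<^sub>M \<mu>)"
        unfolding N_def[symmetric] by measurable
      then show ?thesis unfolding N_def by (rule nn_integral_fst[symmetric])
    qed
    also have "\<dots> = (\<Sum>i\<in>I. \<integral>\<^sup>+y. ennreal (p i y) * h (x i, y) \<partial>\<mu>)"
      by (simp add: nn_integral_count_space_finite g_def T_def)
    finally show ?thesis .
  qed
  have nm: "(\<integral>\<^sup>+y. ennreal (p i y) \<partial>\<mu>) = ennreal (1 / real n)" if "i \<in> I" for i
    using m[OF that] p that
    by (subst nn_integral_eq_integral) (auto simp: integrable_part mass_def Parts_nonneg)
  have fst_m: "emeasure (distr \<pi> borel fst) A
      = ennreal (1 / real n) * (\<Sum>i\<in>I. emeasure (return borel (x i)) A)" if A[measurable]: "A \<in> sets borel" for A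
  proof -
    have [measurable]: "fst \<in> measurable \<pi> (borel :: 'a measure)" "fst \<in> measurable (borel :: ('a \<times> 'a) measure) (borel :: 'a measure)"
      using s by (auto intro!: borel_measurable_continuous_onI continuous_intros cong: measurable_cong_sets)
    have "emeasure (distr \<pi> borel fst) A = (\<integral>\<^sup>+z. indicator A (fst z) \<partial>\<pi>)"
      by (subst nn_integral_indicator[symmetric], simp, subst nn_integral_distr) auto
    also have "\<dots> = (\<Sum>i\<in>I. \<integral>\<^sup>+y. ennreal (p i y) * indicator A (x i) \<partial>\<mu>)"
      by (subst int) simp_all
    also have "\<dots> = (\<Sum>i\<in>I. ennreal (1 / real n) * indicator A (x i))"
      by (intro sum.cong refl) (simp add: nn_integral_multc nm)
    finally show ?thesis using A by (simp add: sum_distrib_left)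
  qed
  \<comment> \<open>The marginal is already a measure, so agreement of the set functions on Borel
    sets identifies it with \<open>empirical_measure n x\<close>; countable additivity of the latter
    comes for free.\<close>
  have "distr \<pi> borel fst = measure_of UNIV (sets borel) (emeasure (distr \<pi> borel fst))"
    using measure_of_of_measure[of "distr \<pi> borel fst"] by simp
  also have "\<dots> = empirical_measure n x"
    unfolding empirical_measure_def by (intro measure_of_eq) (auto simp: fst_m sets.sigma_sets_eq[of borel, simplified])
  finally have 1: "distr \<pi> borel fst = empirical_measure n x" .
  have 2: "distr \<pi> borel snd = \<mu>"
  proof (rule measure_eqI)
    fix A :: "'a set" assume "A \<in> sets (distr \<pi> borel snd)"
    then have A[measurable]: "A \<in> sets borel" by simp
    have [measurable]: "snd \<in> measurable \<pi> (borel :: 'a measure)" "snd \<in> measurable (borel :: ('a \<times> 'a) measure) (borel :: 'a measure)"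
      using s by (auto intro!: borel_measurable_continuous_onI continuous_intros cong: measurable_cong_sets)
    have "emeasure (distr \<pi> borel snd) A = (\<integral>\<^sup>+z. indicator A (snd z) \<partial>\<pi>)"
      by (subst nn_integral_indicator[symmetric], simp, subst nn_integral_distr) auto
    also have "\<dots> = (\<Sum>i\<in>I. \<integral>\<^sup>+y. ennreal (p i y) * indicator A y \<partial>\<mu>)"
      by (subst int) simp_all
    also have "\<dots> = (\<integral>\<^sup>+y. (\<Sum>i\<in>I. ennreal (p i y) * indicator A y) \<partial>\<mu>)"
      by (subst nn_integral_sum) auto
    also have "\<dots> = (\<integral>\<^sup>+y. indicator A y \<partial>\<mu>)"
    proof (intro nn_integral_cong)
      fix y
      have "(\<Sum>i\<in>I. ennreal (p i y)) = 1"
        by (subst sum_ennreal) (simp_all add: Parts_nonneg[OF p] Parts_sum[OF p])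
      then show "(\<Sum>i\<in>I. ennreal (p i y) * indicator A y) = indicator A y"
        by (simp add: sum_distrib_right[symmetric])
    qed
    finally show "emeasure (distr \<pi> borel snd) A = emeasure \<mu> A" by simp
  qed simp
  have "emeasure \<pi> (space \<pi>) = (\<integral>\<^sup>+z. 1 \<partial>\<pi>)" by simp
  also have "\<dots> = (\<Sum>i\<in>I. ennreal (1 / real n))" by (subst int) (simp_all add: nm)
  also have "\<dots> = 1" using n by (simp add: ennreal_of_nat_eq_real_of_nat ennreal_mult[symmetric])
  finally have "prob_space \<pi>" by (rule prob_spaceI)
  then have "\<pi> \<in> couplings (empirical_measure n x) \<mu>"
    using 1 2 s by (simp add: couplings_def space_prob_algebra)
  then have "W1 (empirical_measure n x) \<mu> \<le> (\<integral>\<^sup>+z. ennreal (dist (fst z) (snd z)) \<partial>\<pi>)"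
    unfolding W1_def by (rule INF_lower)
  also have "\<dots> = (\<Sum>i\<in>I. \<integral>\<^sup>+y. ennreal (p i y) * ennreal (dist (x i) y) \<partial>\<mu>)"
    by (subst int) (auto intro!: borel_measurable_continuous_onI continuous_intros)
  also have "\<dots> = (\<Sum>i\<in>I. ennreal (\<integral>y. p i y * dist (x i) y \<partial>\<mu>))"
    by (intro sum.cong refl, subst nn_integral_eq_integral[symmetric])
      (auto simp: integrable_part_dist[OF p] Parts_nonneg[OF p] ennreal_mult)
  also have "\<dots> = ennreal (cost p)"
    unfolding cost_def by (intro sum_ennreal integral_nonneg_AE) (simp add: Parts_nonneg[OF p])
  finally show ?thesis .
qed

lemma const_partition:
  assumes "\<And>i. i \<in> I \<Longrightarrow> 0 \<le> w i" "(\<Sum>i\<in>I. w i) = 1"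
  shows "(\<lambda>i _. w i) \<in> Parts"
  using assms by (auto simp: measurable_partitions_def)

text \<open>First-order optimality of a near-minimiser of the penalised cost makes
  \<open>\<psi>\<^sub>i = 2 M (mass\<^sub>i - 1/n)\<close> an almost optimal dual variable; its \<open>c\<close>-transform
  \<open>min\<^sub>i (d(x\<^sub>i, \<cdot>) + \<psi>\<^sub>i)\<close> is the 1-Lipschitz test function.\<close>

lemma penalised_partition:
  assumes dual: "\<And>f. 1-lipschitz_on UNIV f \<Longrightarrow> (\<Sum>i\<in>I. f (x i)) / real n - (\<integral>y. f y \<partial>\<mu>) \<le> s"
    and M: "M > 0" and \<kappa>: "\<kappa> > 0"
  obtains p where "p \<in> Parts" "cost p + 2 * M * (\<Sum>i\<in>I. (mass p i - 1 / real n)\<^sup>2) \<le> s + \<kappa>"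
proof -
  define Q where "Q p = cost p + M * (\<Sum>i\<in>I. (mass p i - 1 / real n)\<^sup>2)" for p
  \<comment> \<open>Step length from \<open>p\<close> towards a competitor. The second-order term of
    the penalty is at most \<open>M * \<theta>\<^sup>2 * real n\<close>, and \<open>p\<close> misses
    the infimum by less than \<open>\<theta> * \<kappa> / 2\<close>; after division by \<theta> the
    two errors add up to at most \<kappa>.\<close>
  define \<theta> where "\<theta> = min (1/2) (\<kappa> / (2 * M * real n))"
  have \<theta>: "0 < \<theta>" "\<theta> \<le> 1" using M \<kappa> n by (auto simp: \<theta>_def)
  have "\<theta> \<le> \<kappa> / (2 * M * real n)" unfolding \<theta>_def by (rule min.cobounded2)
  then have \<theta>2: "M * \<theta> * real n \<le> \<kappa> / 2" using M n by (simp add: field_simps)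
  have "(\<lambda>i _. 1 / real n) \<in> Parts" using n by (intro const_partition) auto
  then have ne: "Parts \<noteq> {}" by blast
  have bdd: "bdd_below (Q ` Parts)"
    using M by (intro bdd_belowI2[where m=0]) (auto simp: Q_def intro!: add_nonneg_nonneg mult_nonneg_nonneg sum_nonneg cost_nonneg)
  have "\<exists>z\<in>Q ` Parts. z < Inf (Q ` Parts) + \<theta> * \<kappa> / 2"
    using ne \<theta> \<kappa> by (intro cInf_lessD) auto
  then obtain p where p: "p \<in> Parts" "Q p < Inf (Q ` Parts) + \<theta> * \<kappa> / 2" by blast
  have Qp: "Q p \<le> Q r + \<theta> * \<kappa> / 2" if "r \<in> Parts" for r
    using p(2) cINF_lower[OF bdd that] by linarith
  define e where "e i = mass p i - 1 / real n" for i
  \<comment> \<open>Comparing \<open>p\<close> with the mixture \<open>r\<close> turns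
    near-minimality of the quadratic penalty into near-minimality of its linearisation at
    \<open>p\<close>. No minimiser, and hence no compactness, is required.\<close>
  have opt: "cost p + 2 * M * (\<Sum>i\<in>I. e i * mass p i) \<le> cost q + 2 * M * (\<Sum>i\<in>I. e i * mass q i) + \<kappa>"
    if q: "q \<in> Parts" for q
  proof -
    define r where "r = (\<lambda>i y. (1 - \<theta>) * p i y + \<theta> * q i y)"
    have r: "r \<in> Parts" unfolding r_def using p(1) q \<theta> by (intro measurable_partitions_convex) auto
    define \<delta> where "\<delta> i = mass q i - mass p i" for i
    have "mass r i - 1 / real n = e i + \<theta> * \<delta> i" if "i \<in> I" for i
      using mass_convex[OF p(1) q that, of \<theta>] by (simp add: r_def e_def \<delta>_def algebra_simps)
    then have "(\<Sum>i\<in>I. (mass r i - 1 / real n)\<^sup>2) = (\<Sum>i\<in>I. (e i + \<theta> * \<delta> i)\<^sup>2)"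
      by (intro sum.cong) auto
    also have "\<dots> = (\<Sum>i\<in>I. (e i)\<^sup>2) + 2 * \<theta> * (\<Sum>i\<in>I. e i * \<delta> i) + \<theta>\<^sup>2 * (\<Sum>i\<in>I. (\<delta> i)\<^sup>2)"
      by (simp add: power2_sum sum.distrib sum_distrib_left power_mult_distrib algebra_simps)
    also have "\<dots> \<le> (\<Sum>i\<in>I. (e i)\<^sup>2) + 2 * \<theta> * (\<Sum>i\<in>I. e i * \<delta> i) + \<theta>\<^sup>2 * real n"
    proof -
      have "(\<delta> i)\<^sup>2 \<le> 1" if "i \<in> I" for i
        using mass_nonneg[OF p(1) that] mass_le_1[OF p(1) that] mass_nonneg[OF q that] mass_le_1[OF q that]
        by (simp add: \<delta>_def abs_square_le_1 abs_le_iff)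
      then have "(\<Sum>i\<in>I. (\<delta> i)\<^sup>2) \<le> (\<Sum>i\<in>I. 1)" by (intro sum_mono)
      then show ?thesis by (intro add_left_mono mult_left_mono) auto
    qed
    finally have "Q r \<le> ((1 - \<theta>) * cost p + \<theta> * cost q)
        + M * ((\<Sum>i\<in>I. (e i)\<^sup>2) + 2 * \<theta> * (\<Sum>i\<in>I. e i * \<delta> i) + \<theta>\<^sup>2 * real n)"
      using M cost_convex[OF p(1) q, of \<theta>] by (simp add: Q_def r_def)
    with Qp[OF r] have "0 \<le> \<theta> * (cost q - cost p + 2 * M * (\<Sum>i\<in>I. e i * \<delta> i) + M * \<theta> * real n + \<kappa> / 2)"
      by (simp add: Q_def e_def[symmetric] algebra_simps power2_eq_square)
    then have "0 \<le> cost q - cost p + 2 * M * (\<Sum>i\<in>I. e i * \<delta> i) + M * \<theta> * real n + \<kappa> / 2"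
      using \<theta> by (simp add: zero_le_mult_iff)
    moreover have "(\<Sum>i\<in>I. e i * \<delta> i) = (\<Sum>i\<in>I. e i * mass q i) - (\<Sum>i\<in>I. e i * mass p i)"
      by (simp add: \<delta>_def right_diff_distrib sum_subtractf)
    ultimately have "0 \<le> cost q - cost p
        + 2 * M * ((\<Sum>i\<in>I. e i * mass q i) - (\<Sum>i\<in>I. e i * mass p i)) + M * \<theta> * real n + \<kappa> / 2"
      by simp
    then show ?thesis using \<theta>2 unfolding right_diff_distrib by linarith
  qed
  define \<psi> where "\<psi> i = 2 * M * e i" for i
  define g where "g i y = dist (x i) y + \<psi> i" for i y
  have [measurable]: "g i \<in> borel_measurable borel" for i unfolding g_def by measurable
  have ne: "I \<noteq> {}" using n by auto
  \<comment> \<open>This competitor minimises the linearised cost pointwise, so its linearised cost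
    is exactly the integral of \<phi>.\<close>
  obtain q where q: "q \<in> Parts" "\<And>y. (\<Sum>i\<in>I. q i y * g i y) = Min ((\<lambda>i. g i y) ` I)"
    using argmin_partition[of I g] ne by auto
  define \<phi> where "\<phi> y = Min ((\<lambda>i. g i y) ` I)" for y
  have \<phi>_le: "\<phi> y \<le> g i y" if "i \<in> I" for i y
    unfolding \<phi>_def using that by (intro Min_le) auto
  have lip: "1-lipschitz_on UNIV \<phi>"
  proof (rule lipschitz_1I)
    fix y z
    have "\<phi> z \<in> (\<lambda>i. g i z) ` I" unfolding \<phi>_def using ne by (intro Min_in) auto
    then obtain i where i: "i \<in> I" "\<phi> z = g i z" by auto
    then show "\<phi> y - \<phi> z \<le> dist y z"
      using \<phi>_le[OF i(1), of y] dist_triangle[of "x i" y z] by (simp add: g_def dist_commute)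
  qed
  have "(\<integral>y. \<phi> y \<partial>\<mu>) = (\<integral>y. (\<Sum>i\<in>I. q i y * g i y) \<partial>\<mu>)" by (simp only: q(2) \<phi>_def)
  also have "\<dots> = (\<Sum>i\<in>I. (\<integral>y. q i y * dist (x i) y \<partial>\<mu>) + \<psi> i * mass q i)"
  proof (subst Bochner_Integration.integral_sum)
    have *: "(\<lambda>y. q i y * g i y) = (\<lambda>y. q i y * dist (x i) y + \<psi> i * q i y)" for i
      by (auto simp: g_def algebra_simps)
    show "integrable \<mu> (\<lambda>y. q i y * g i y)" if "i \<in> I" for i
      unfolding * using integrable_part_dist[OF q(1) that] integrable_part[OF q(1) that] by simp
    show "(\<Sum>i\<in>I. \<integral>y. q i y * g i y \<partial>\<mu>) = (\<Sum>i\<in>I. (\<integral>y. q i y * dist (x i) y \<partial>\<mu>) + \<psi> i * mass q i)"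
      unfolding * mass_def using integrable_part_dist[OF q(1)] integrable_part[OF q(1)]
      by (intro sum.cong) auto
  qed
  finally have I\<phi>: "(\<integral>y. \<phi> y \<partial>\<mu>) = cost q + 2 * M * (\<Sum>i\<in>I. e i * mass q i)"
    by (simp add: cost_def sum.distrib \<psi>_def sum_distrib_left mult.assoc)
  \<comment> \<open>The sign is reversed because \<open>dual\<close> bounds empirical mean minus
    mean. At the atoms, \<phi> is at most \<psi>, since the distance of \<open>x i\<close> to itself
    vanishes.\<close>
  have "1-lipschitz_on UNIV (\<lambda>y. - \<phi> y)"
    using lipschitz_1D[OF lip] by (intro lipschitz_1I) (auto simp: abs_le_iff)
  from dual[OF this] have "(\<integral>y. \<phi> y \<partial>\<mu>) \<le> s + (\<Sum>i\<in>I. \<phi> (x i)) / real n"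
    by (simp add: sum_negf)
  also have "(\<Sum>i\<in>I. \<phi> (x i)) \<le> (\<Sum>i\<in>I. \<psi> i)"
    using \<phi>_le by (intro sum_mono) (metis add_0 dist_self g_def)
  finally have "(\<integral>y. \<phi> y \<partial>\<mu>) \<le> s + (\<Sum>i\<in>I. \<psi> i) / real n"
    using n by (simp add: divide_right_mono)
  moreover have "(\<Sum>i\<in>I. \<psi> i) / real n = 2 * M * ((\<Sum>i\<in>I. e i) / real n)"
    by (simp add: \<psi>_def sum_distrib_left)
  ultimately have "cost p + 2 * M * ((\<Sum>i\<in>I. e i * mass p i) - (\<Sum>i\<in>I. e i) / real n) \<le> s + \<kappa>"
    using opt[OF q(1)] I\<phi> unfolding right_diff_distrib by linarith
  also have "(\<Sum>i\<in>I. e i * mass p i) - (\<Sum>i\<in>I. e i) / real n = (\<Sum>i\<in>I. (e i)\<^sup>2)"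
    by (simp add: sum_divide_distrib sum_subtractf[symmetric] power2_eq_square)
      (simp add: e_def right_diff_distrib)
  finally show ?thesis using that[OF p(1)] by (simp add: e_def)
qed

text \<open>The penalty yields a partition of cost at most \<open>s + \<epsilon>\<close> whose
  masses are only close to \<open>1 / real n\<close>. Mixing in a small multiple of a constant
  partition makes the masses exact, at an extra cost of at most \<epsilon>.\<close>

lemma W1_empirical_le:
  assumes dual: "\<And>f. 1-lipschitz_on UNIV f \<Longrightarrow> (\<Sum>i\<in>I. f (x i)) / real n - (\<integral>y. f y \<partial>\<mu>) \<le> s"
  shows "W1 (empirical_measure n x) \<mu> \<le> ennreal s"
proof -
  have s: "s \<ge> 0" using dual[of "\<lambda>_. 0"] by (simp add: lipschitz_on_def)
  define D where "D = (\<Sum>i\<in>I. \<integral>y. dist (x i) y \<partial>\<mu>)"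
  have D: "D \<ge> 0" unfolding D_def by (intro sum_nonneg integral_nonneg_AE) simp
  have main: "W1 (empirical_measure n x) \<mu> \<le> ennreal (s + 2 * \<epsilon>)" if \<epsilon>: "\<epsilon> > 0" for \<epsilon>
  proof -
    \<comment> \<open>Any constant partition costs at most \<open>D\<close>, so the correction of
      weight \<theta> costs at most \<epsilon>; \<open>D + 1\<close> avoids dividing by 0.\<close>
    define \<theta> where "\<theta> = min (1/2) (\<epsilon> / (D + 1))"
    have \<theta>: "0 < \<theta>" "\<theta> < 1" using \<epsilon> D by (auto simp: \<theta>_def)
    have "\<theta> \<le> \<epsilon> / (D + 1)" unfolding \<theta>_def by (rule min.cobounded2)
    then have "\<theta> * (D + 1) \<le> \<epsilon>" using D by (simp add: pos_le_divide_eq)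
    then have \<theta>D: "\<theta> * D \<le> \<epsilon>" using \<theta> by (simp add: algebra_simps)
    \<comment> \<open>Chosen so that a penalty of at most \<open>s + \<epsilon>\<close> forces every
      mass to within \<open>\<theta> / real n\<close> of \<open>1 / real n\<close>.\<close>
    define M where "M = (s + \<epsilon>) / (2 * (\<theta> / real n)\<^sup>2)"
    have M: "M > 0" using s \<epsilon> \<theta> n by (simp add: M_def)
    obtain p where p: "p \<in> Parts"
      "cost p + 2 * M * (\<Sum>i\<in>I. (mass p i - 1 / real n)\<^sup>2) \<le> s + \<epsilon>"
      using penalised_partition[OF dual M \<epsilon>] by blast
    have M0: "0 \<le> 2 * M * (\<Sum>i\<in>I. (mass p i - 1 / real n)\<^sup>2)"
      using M by (intro mult_nonneg_nonneg sum_nonneg) auto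
    have cp: "cost p \<le> s + \<epsilon>" using p(2) M0 by linarith
    have "2 * M * (\<Sum>i\<in>I. (mass p i - 1 / real n)\<^sup>2) \<le> s + \<epsilon>" using p cost_nonneg[OF p(1)] by linarith
    also have "s + \<epsilon> = 2 * M * (\<theta> / real n)\<^sup>2" using \<theta> n by (simp add: M_def)
    finally have S: "(\<Sum>i\<in>I. (mass p i - 1 / real n)\<^sup>2) \<le> (\<theta> / real n)\<^sup>2" using M by simp
    have e: "\<bar>mass p i - 1 / real n\<bar> \<le> \<theta> / real n" if "i \<in> I" for i
    proof -
      have "(mass p i - 1 / real n)\<^sup>2 \<le> (\<Sum>i\<in>I. (mass p i - 1 / real n)\<^sup>2)"
        using that by (intro member_le_sum) auto
      then have "(mass p i - 1 / real n)\<^sup>2 \<le> (\<theta> / real n)\<^sup>2" using S by linarith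
      then have "\<bar>mass p i - 1 / real n\<bar> \<le> \<bar>\<theta> / real n\<bar>" by (simp only: abs_le_square_iff)
      then show ?thesis using \<theta> by simp
    qed
    \<comment> \<open>Solves \<open>(1 - \<theta>) * mass p i + \<theta> * w i = 1 / real n\<close>.
      It is nonnegative since \<open>mass p i\<close> is at most
      \<open>(1 + \<theta>) / real n\<close>.\<close>
    define w where "w i = (1 / real n - (1 - \<theta>) * mass p i) / \<theta>" for i
    have w0: "0 \<le> w i" if "i \<in> I" for i
    proof -
      have "(1 - \<theta>) * (mass p i - 1 / real n) \<le> (1 - \<theta>) * (\<theta> / real n)"
        using e[OF that] \<theta> by (intro mult_left_mono) auto
      also have "\<dots> \<le> 1 * (\<theta> / real n)" using \<theta> by (intro mult_right_mono) auto
      finally have "0 \<le> 1 / real n - (1 - \<theta>) * mass p i" by (simp add: algebra_simps diff_divide_distrib)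
      then show ?thesis using \<theta> by (simp add: w_def)
    qed
    have w1: "(\<Sum>i\<in>I. w i) = 1"
      using n \<theta> mass_sum[OF p(1)]
      by (simp add: w_def sum_divide_distrib[symmetric] sum_subtractf sum_distrib_left[symmetric])
    have w: "(\<lambda>i _. w i) \<in> Parts" by (rule const_partition[OF w0 w1])
    define r where "r = (\<lambda>i y. (1 - \<theta>) * p i y + \<theta> * w i)"
    have r: "r \<in> Parts" unfolding r_def using p(1) w \<theta> by (intro measurable_partitions_convex[where q="\<lambda>i _. w i"]) auto
    have "mass r i = 1 / real n" if "i \<in> I" for i
    proof -
      have "mass r i = (1 - \<theta>) * mass p i + \<theta> * mass (\<lambda>i _. w i) i"
        unfolding r_def by (rule mass_convex[OF p(1) w that])
      also have "mass (\<lambda>i _. w i) i = w i" by (simp add: mass_def prob_space)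
      finally show ?thesis using \<theta> by (simp add: w_def)
    qed
    then have "W1 (empirical_measure n x) \<mu> \<le> ennreal (cost r)" by (rule W1_le_cost[OF r])
    also have "cost r \<le> s + 2 * \<epsilon>"
    proof -
      have "cost (\<lambda>i _. w i) \<le> D" unfolding cost_def D_def
        using Parts_le_1[OF w] w0 by (intro sum_mono) (simp add: mult_left_le_one_le integral_nonneg_AE)
      then have "\<theta> * cost (\<lambda>i _. w i) \<le> \<epsilon>" using \<theta>D \<theta> mult_left_mono[of "cost (\<lambda>i _. w i)" D \<theta>] by linarith
      moreover have "(1 - \<theta>) * cost p \<le> cost p" using \<theta> cost_nonneg[OF p(1)] by (simp add: mult_left_le_one_le)
      moreover have "cost r = (1 - \<theta>) * cost p + \<theta> * cost (\<lambda>i _. w i)"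
        unfolding r_def by (rule cost_convex[OF p(1) w])
      ultimately show ?thesis using cp by linarith
    qed
    finally show ?thesis by (simp add: ennreal_leI)
  qed
  show ?thesis
  proof (rule ennreal_le_epsilon)
    fix \<epsilon> :: real assume "\<epsilon> > 0"
    then show "W1 (empirical_measure n x) \<mu> \<le> ennreal s + ennreal \<epsilon>"
      using main[of "\<epsilon> / 2"] s by simp
  qed
qed

end

section \<open>Lipschitz functions on a compact set and the tail integral\<close>

text \<open>McShane's formula: the infimum over \<open>z\<close> in \<open>K\<close> of
  \<open>g z + dist x z\<close> is the largest 1-Lipschitz extension.\<close>

lemma lipschitz_1_extension:
  fixes g :: "'a::metric_space \<Rightarrow> real"
  assumes K: "K \<noteq> {}" and g: "1-lipschitz_on K g"
  obtains f where "1-lipschitz_on UNIV f" "\<And>x. x \<in> K \<Longrightarrow> f x = g x"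
proof
  define f where "f x = (INF z\<in>K. g z + dist x z)" for x
  have ge: "g y - dist x y \<le> g z + dist x z" if "y \<in> K" "z \<in> K" for x y z
    using lipschitz_onD[OF g that] dist_triangle3[of y z x] by (simp add: dist_real_def)
  have lower: "f x \<le> g z + dist x z" if "z \<in> K" for x z
    unfolding f_def using that ge[OF that] by (intro cINF_lower bdd_belowI2) auto
  show "f x = g x" if "x \<in> K" for x
  proof (rule antisym)
    show "f x \<le> g x" using lower[OF that, of x] by simp
    show "g x \<le> f x" unfolding f_def using K ge[OF that, of _ x] by (intro cINF_greatest) auto
  qed
  show "1-lipschitz_on UNIV f"
  proof (rule lipschitz_1I)
    fix x y
    have "f x - dist x y \<le> f y"
      unfolding f_def[of y]
    proof (rule cINF_greatest[OF K])
      fix z assume "z \<in> K"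
      then show "f x - dist x y \<le> g z + dist y z"
        using lower[of z x] dist_triangle[of x z y] by simp
    qed
    then show "f x - f y \<le> dist x y" by simp
  qed
qed

lemma lip_functionsD:
  assumes "f \<in> lip_functions K x\<^sub>0"
  shows "x \<in> K \<Longrightarrow> y \<in> K \<Longrightarrow> \<bar>f x - f y\<bar> \<le> dist x y" "f x\<^sub>0 = 0" "1-lipschitz_on K f"
  using assms lipschitz_onD[of 1 K f x y] by (auto simp: lip_functions_def dist_real_def)

text \<open>A real supremum bounds its members only if they are bounded; here compactness of
  \<open>K\<close> and the common value 0 at \<open>x\<^sub>0\<close> ensure this.\<close>

lemma lip_functions_uniform_distD:
  assumes K: "compact K" "x\<^sub>0 \<in> K" and f: "f \<in> lip_functions K x\<^sub>0" "g \<in> lip_functions K x\<^sub>0"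
    and d: "uniform_dist K f g \<le> \<delta>" and x: "x \<in> K"
  shows "\<bar>f x - g x\<bar> \<le> \<delta>"
proof -
  obtain B where B: "\<And>x. x \<in> K \<Longrightarrow> dist x x\<^sub>0 \<le> B"
    using compact_imp_bounded[OF K(1)] by (metis bounded_any_center dist_commute)
  have "\<bar>f x - g x\<bar> \<le> 2 * B" if "x \<in> K" for x
    using lip_functionsD(1)[OF f(1) that K(2)] lip_functionsD(1)[OF f(2) that K(2)] B[OF that]
      lip_functionsD(2)[OF f(1)] lip_functionsD(2)[OF f(2)] by linarith
  then have "bdd_above ((\<lambda>x. \<bar>f x - g x\<bar>) ` K)" by (intro bdd_aboveI2)
  then have "\<bar>f x - g x\<bar> \<le> uniform_dist K f g"
    unfolding uniform_dist_def using x by (intro cSUP_upper)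
  with d show ?thesis by simp
qed

text \<open>Round the values on a finite \<epsilon>-net of \<open>K\<close> to multiples of
  \<epsilon>. Only finitely many codes occur, and functions with equal codes differ by at most three
  times \<epsilon>: once for the rounding, twice for moving to the net.\<close>

lemma lip_functions_totally_bounded:
  fixes K :: "'a::metric_space set"
  assumes K: "compact K" "x\<^sub>0 \<in> K" and \<delta>: "\<delta> > 0"
  shows "\<exists>C. C \<subseteq> lip_functions K x\<^sub>0 \<and> finite C \<and>
    lip_functions K x\<^sub>0 \<subseteq> (\<Union>c\<in>C. {f \<in> lip_functions K x\<^sub>0. uniform_dist K c f \<le> \<delta>})"
proof -
  let ?A = "lip_functions K x\<^sub>0"
  define \<epsilon> where "\<epsilon> = \<delta> / 3"
  have \<epsilon>: "\<epsilon> > 0" using \<delta> by (simp add: \<epsilon>_def)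
  obtain Z where Z: "finite Z" "Z \<subseteq> K" "K \<subseteq> (\<Union>z\<in>Z. ball z \<epsilon>)"
    using seq_compact_imp_totally_bounded[OF compact_imp_seq_compact[OF K(1)], rule_format, OF \<epsilon>]
    by metis
  obtain B where B: "\<And>x. x \<in> K \<Longrightarrow> dist x x\<^sub>0 \<le> B"
    using compact_imp_bounded[OF K(1)] by (metis bounded_any_center dist_commute)
  define code where "code f = (\<lambda>z\<in>Z. \<lfloor>f z / \<epsilon>\<rfloor>)" for f :: "'a \<Rightarrow> real"
  have "code ` ?A \<subseteq> PiE Z (\<lambda>_. {\<lfloor>- B / \<epsilon>\<rfloor>..\<lfloor>B / \<epsilon>\<rfloor>})"
  proof (rule image_subsetI)
    fix f assume f: "f \<in> ?A"
    have "- B / \<epsilon> \<le> f z / \<epsilon> \<and> f z / \<epsilon> \<le> B / \<epsilon>" if "z \<in> Z" for z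
    proof -
      have "z \<in> K" using that Z by auto
      then have "- B \<le> f z \<and> f z \<le> B"
        using lip_functionsD(1)[OF f _ K(2), of z] lip_functionsD(2)[OF f] B[of z] by auto
      then show ?thesis
        using divide_right_mono[of "- B" "f z" \<epsilon>] divide_right_mono[of "f z" B \<epsilon>] \<epsilon> by simp
    qed
    then show "code f \<in> PiE Z (\<lambda>_. {\<lfloor>- B / \<epsilon>\<rfloor>..\<lfloor>B / \<epsilon>\<rfloor>})"
      unfolding code_def by (intro PiE_I) (auto intro!: floor_mono)
  qed
  moreover have "finite (PiE Z (\<lambda>_. {\<lfloor>- B / \<epsilon>\<rfloor>..\<lfloor>B / \<epsilon>\<rfloor>}))" using Z(1) by (intro finite_PiE) auto
  ultimately have "finite (code ` ?A)" by (rule finite_subset)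
  \<comment> \<open>One representative per code, so the centres belong to the family itself, as
    \<open>covering_number\<close> demands.\<close>
  then obtain C where C: "C \<subseteq> ?A" "finite C" "code ` ?A = code ` C"
    using finite_subset_image[of "code ` ?A" code ?A] by blast
  have "\<exists>c\<in>C. uniform_dist K c f \<le> \<delta>" if f: "f \<in> ?A" for f
  proof -
    obtain c where c: "c \<in> C" "code f = code c" using C(3) f by blast
    have cA: "c \<in> ?A" using c C by auto
    have "\<bar>c x - f x\<bar> \<le> \<delta>" if x: "x \<in> K" for x
    proof -
      obtain z where z: "z \<in> Z" "dist z x < \<epsilon>" using Z(3) x by auto
      then have zK: "z \<in> K" using Z by auto
      have "\<lfloor>f z / \<epsilon>\<rfloor> = \<lfloor>c z / \<epsilon>\<rfloor>" using fun_cong[OF c(2), of z] z by (simp add: code_def)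
      then have "\<bar>c z / \<epsilon> - f z / \<epsilon>\<bar> \<le> 1" by linarith
      then have "\<bar>c z - f z\<bar> \<le> \<epsilon>" using \<epsilon> by (simp add: diff_divide_distrib[symmetric] abs_divide)
      then show ?thesis
        using lip_functionsD(1)[OF f zK x] lip_functionsD(1)[OF cA zK x] z(2)
        unfolding \<epsilon>_def by linarith
    qed
    then have "uniform_dist K c f \<le> \<delta>"
      unfolding uniform_dist_def using K(2) by (intro cSUP_least) auto
    then show ?thesis using c(1) by auto
  qed
  then show ?thesis using C by (intro exI[of _ C]) blast
qed

lemma covering_number_obtain:
  assumes "\<exists>C. C \<subseteq> A \<and> finite C \<and> A \<subseteq> (\<Union>c\<in>C. {x \<in> A. d c x \<le> \<delta>})"
  obtains C where "C \<subseteq> A" "finite C" "card C = covering_number A d \<delta>"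
    "\<And>x. x \<in> A \<Longrightarrow> \<exists>c\<in>C. d c x \<le> \<delta>"
proof -
  let ?Q = "\<lambda>k. \<exists>C. C \<subseteq> A \<and> finite C \<and> card C = k \<and> A \<subseteq> (\<Union>c\<in>C. {x \<in> A. d c x \<le> \<delta>})"
  have "\<exists>k. ?Q k" using assms by blast
  then have "?Q (LEAST k. ?Q k)" by (rule LeastI_ex)
  then obtain C where C: "C \<subseteq> A" "finite C" "card C = covering_number A d \<delta>"
    "A \<subseteq> (\<Union>c\<in>C. {x \<in> A. d c x \<le> \<delta>})"
    unfolding covering_number_def by auto
  show ?thesis using C(4) by (intro that[OF C(1-3)]) auto
qed

text \<open>Fenchel-Young for the exponential, whose conjugate is \<open>s * ln s - s\<close>: the
  tangent line at 0, evaluated at \<open>v - ln s\<close>.\<close>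

lemma young_exp:
  fixes s v :: real
  assumes "s > 0"
  shows "s * v \<le> s * ln s - s + exp v"
proof -
  have "s * (1 + (v - ln s)) \<le> s * exp (v - ln s)"
    using assms by (intro mult_left_mono) auto
  also have "\<dots> = exp v" using assms by (simp add: exp_diff)
  finally show ?thesis by (simp add: algebra_simps)
qed

text \<open>Young's inequality with \<open>s = 32 / (a * t)\<close> and
  \<open>v = a * dist x x\<^sub>0\<close> makes the bracket \<open>b\<close> appear on
  \<open>A\<close>. Integration gives at most \<open>b * measure \<mu> A\<close> plus the
  exponential moment minus 1, hence at most 2; division by \<open>s * a = 32 / t\<close> yields
  \<open>t / 16\<close>.\<close>

lemma exp_moment_tail:
  fixes \<mu> :: "'a::polish_space measure"
  assumes \<mu>: "prob_space \<mu>" and sets[measurable_cong]: "sets \<mu> = sets borel"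
    and t: "t > 0" and a: "a > 0"
    and E: "(\<integral>\<^sup>+ x. ennreal (exp (a * dist x\<^sub>0 x)) \<partial>\<mu>) \<le> 2"
    and A[measurable]: "A \<in> sets borel"
    and tail: "emeasure \<mu> A \<le>
      inverse (ennreal (32 / (a * t) * ln (32 / (a * t)) - 32 / (a * t) + 1))"
  shows "integrable \<mu> (\<lambda>x. dist x x\<^sub>0)"
    and "(\<integral>x. indicator A x * dist x x\<^sub>0 \<partial>\<mu>) \<le> t / 16"
proof -
  interpret prob_space \<mu> by fact
  define s where "s = 32 / (a * t)"
  have s: "s > 0" using a t by (simp add: s_def)
  define b where "b = s * ln s - s + 1"
  have b: "b \<ge> 0" using young_exp[OF s, of 0] by (simp add: b_def)
  define e where "e x = exp (a * dist x x\<^sub>0)" for x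
  have [measurable]: "e \<in> borel_measurable borel" unfolding e_def by measurable
  have Ee: "(\<integral>\<^sup>+x. ennreal (e x) \<partial>\<mu>) \<le> 2" using E by (simp add: e_def dist_commute)
  have inte: "integrable \<mu> e"
    by (rule integrableI_nonneg) (use Ee in \<open>auto simp: e_def intro: le_less_trans\<close>)
  have "ennreal (\<integral>x. e x \<partial>\<mu>) \<le> ennreal 2"
    using Ee inte by (subst nn_integral_eq_integral[symmetric]) (auto simp: e_def)
  then have e2: "(\<integral>x. e x \<partial>\<mu>) \<le> 2" by (subst (asm) ennreal_le_iff) simp_all
  show d: "integrable \<mu> (\<lambda>x. dist x x\<^sub>0)"
  proof (rule Bochner_Integration.integrable_bound[where f="\<lambda>x. e x / a"])
    show "AE x in \<mu>. norm (dist x x\<^sub>0) \<le> norm (e x / a)"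
    proof (rule AE_I2)
      fix x
      have "a * dist x x\<^sub>0 \<le> e x" unfolding e_def using exp_ge_add_one_self[of "a * dist x x\<^sub>0"] by linarith
      then show "norm (dist x x\<^sub>0) \<le> norm (e x / a)" using a by (simp add: e_def field_simps)
    qed
  qed (use inte in auto)
  have bm: "b * measure \<mu> A \<le> 1"
  \<comment> \<open>For \<open>b = 0\<close> the inverse is infinite and \<open>tail\<close> says
    nothing, but the product is then 0.\<close>
  proof (cases "b = 0")
    case False
    then have "ennreal (measure \<mu> A) \<le> ennreal (inverse b)"
      using tail b unfolding s_def[symmetric] b_def[symmetric] by (simp add: emeasure_eq_measure inverse_ennreal)
    then show ?thesis using b False by (simp add: ennreal_le_iff field_simps)
  qed simp
  have iA: "integrable \<mu> (\<lambda>x. indicator A x * dist x x\<^sub>0)"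
    by (rule Bochner_Integration.integrable_bound[OF d]) (auto simp: indicator_def)
  have iI: "integrable \<mu> (indicat_real A)"
    by (rule integrable_const_bound[where B=1]) (auto simp: indicator_def)
  \<comment> \<open>Off \<open>A\<close> the left side vanishes and the right side is
    \<open>e x - 1\<close>, which is nonnegative.\<close>
  have "(\<integral>x. s * a * (indicator A x * dist x x\<^sub>0) \<partial>\<mu>) \<le> (\<integral>x. b * indicator A x + (e x - 1) \<partial>\<mu>)"
  proof (rule integral_mono)
    fix x
    show "s * a * (indicator A x * dist x x\<^sub>0) \<le> b * indicator A x + (e x - 1)"
      using young_exp[OF s, of "a * dist x x\<^sub>0"] a by (auto simp: e_def b_def indicator_def)
  qed (use iA iI inte in auto)
  also have "\<dots> = b * measure \<mu> A + ((\<integral>x. e x \<partial>\<mu>) - 1)"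
    using inte iI by (simp add: prob_space sets)
  also have "\<dots> \<le> 2" using bm e2 by simp
  finally have "s * a * (\<integral>x. indicator A x * dist x x\<^sub>0 \<partial>\<mu>) \<le> 2" by simp
  moreover have "s * a = 32 / t" using a by (simp add: s_def)
  ultimately have "32 / t * (\<integral>x. indicator A x * dist x x\<^sub>0 \<partial>\<mu>) \<le> 2" by (simp only:)
  then show "(\<integral>x. indicator A x * dist x x\<^sub>0 \<partial>\<mu>) \<le> t / 16"
    using t by (simp add: field_simps)
qed

section \<open>Concentration of the dual functional\<close>

context borel_prob_first_moment begin

declare One_nat_def [simp del]

definition discrepancy :: "nat \<Rightarrow> ('a \<Rightarrow> real) \<Rightarrow> (nat \<Rightarrow> 'a) \<Rightarrow> real"
  where "discrepancy n f x = (\<Sum>i\<in>{1..n}. f (x i)) / real n - (\<integral>y. f y \<partial>\<mu>)"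

text \<open>The Kantorovich-Rubinstein dual expression for the distance between the empirical
  measure and \<mu>.\<close>

definition KR_sup :: "nat \<Rightarrow> (nat \<Rightarrow> 'a) \<Rightarrow> real"
  where "KR_sup n x = (SUP f\<in>{f. 1-lipschitz_on UNIV f}. discrepancy n f x)"

lemma lipschitz_1_nonempty: "{f :: 'a \<Rightarrow> real. 1-lipschitz_on UNIV f} \<noteq> {}"
proof -
  have "1-lipschitz_on UNIV (\<lambda>_ :: 'a. 0 :: real)" by (simp add: lipschitz_on_def)
  then show ?thesis by blast
qed

lemma discrepancy_minus_const:
  assumes "n \<ge> 1" "1-lipschitz_on UNIV f"
  shows "discrepancy n (\<lambda>x. f x - b) x = discrepancy n f x"
  using assms integrable_lipschitz[OF assms(2)]
  by (simp add: discrepancy_def sum_subtractf diff_divide_distrib)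

lemma discrepancy_diff_le:
  assumes n: "n \<ge> 1" and f: "1-lipschitz_on UNIV f"
  shows "discrepancy n f x - discrepancy n f y \<le> (\<Sum>i\<in>{1..n}. dist (x i) (y i)) / real n"
proof -
  have "discrepancy n f x - discrepancy n f y = (\<Sum>i\<in>{1..n}. f (x i) - f (y i)) / real n"
    by (simp add: discrepancy_def sum_subtractf diff_divide_distrib)
  also have "\<dots> \<le> (\<Sum>i\<in>{1..n}. dist (x i) (y i)) / real n"
    using lipschitz_1D[OF f] by (intro divide_right_mono sum_mono) (auto simp: abs_le_iff)
  finally show ?thesis .
qed

text \<open>The supremum is finite: when all sample points equal \<open>x\<^sub>0\<close> each
  discrepancy is at most the first moment, and moving to \<open>x\<close> costs at most the mean
  displacement, uniformly in the test function.\<close>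

lemma discrepancy_le_KR_sup:
  assumes n: "n \<ge> 1" and f: "1-lipschitz_on UNIV f"
  shows "discrepancy n f x \<le> KR_sup n x"
  unfolding KR_sup_def
proof (rule cSUP_upper)
  show "bdd_above ((\<lambda>f. discrepancy n f x) ` {f. 1-lipschitz_on UNIV f})"
  proof (rule bdd_aboveI2)
    fix g assume "g \<in> {f :: 'a \<Rightarrow> real. 1-lipschitz_on UNIV f}"
    then have g: "1-lipschitz_on UNIV g" by simp
    have "(\<integral>y. g x\<^sub>0 - g y \<partial>\<mu>) \<le> (\<integral>y. dist y x\<^sub>0 \<partial>\<mu>)"
      using integrable_lipschitz[OF g] integrable_dist0 lipschitz_1D[OF g]
      by (intro integral_mono) (auto simp: abs_le_iff)
    then have "discrepancy n g (\<lambda>_. x\<^sub>0) \<le> (\<integral>y. dist y x\<^sub>0 \<partial>\<mu>)"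
      using n integrable_lipschitz[OF g] by (simp add: discrepancy_def)
    then show "discrepancy n g x \<le> (\<integral>y. dist y x\<^sub>0 \<partial>\<mu>) + (\<Sum>i\<in>{1..n}. dist (x i) x\<^sub>0) / real n"
      using discrepancy_diff_le[OF n g, of x "\<lambda>_. x\<^sub>0"] by simp
  qed
qed (use f in simp)

lemma KR_sup_least:
  assumes "\<And>f. 1-lipschitz_on UNIV f \<Longrightarrow> discrepancy n f x \<le> b"
  shows "KR_sup n x \<le> b"
  unfolding KR_sup_def using assms by (intro cSUP_least lipschitz_1_nonempty) auto

lemma W1_le_KR_sup:
  assumes "n \<ge> 1" shows "W1 (empirical_measure n x) \<mu> \<le> ennreal (KR_sup n x)"
proof -
  interpret semidiscrete \<mu> x\<^sub>0 n x by standard fact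
  show ?thesis
    by (rule W1_empirical_le)
      (use discrepancy_le_KR_sup[OF assms] in \<open>simp add: discrepancy_def\<close>)
qed

lemma sum_lipschitz_KR_sup:
  assumes n: "n \<ge> 1" shows "sum_lipschitz {1..n} (\<lambda>x. real n * KR_sup n x)"
proof (rule sum_lipschitzI)
  fix x y
  have "KR_sup n x \<le> KR_sup n y + (\<Sum>i\<in>{1..n}. dist (x i) (y i)) / real n"
  proof (rule KR_sup_least)
    fix f :: "'a \<Rightarrow> real" assume f: "1-lipschitz_on UNIV f"
    show "discrepancy n f x \<le> KR_sup n y + (\<Sum>i\<in>{1..n}. dist (x i) (y i)) / real n"
      using discrepancy_diff_le[OF n f, of x y] discrepancy_le_KR_sup[OF n f, of y] by linarith
  qed
  then show "real n * KR_sup n x - real n * KR_sup n y \<le> (\<Sum>i\<in>{1..n}. dist (x i) (y i))"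
    using n by (simp add: field_simps)
qed

text \<open>Points of the product space are undefined off \<open>{1..n}\<close>, whereas the sample
  enters \<open>empirical_measure\<close> unrestricted.\<close>

lemma KR_sup_restrict: "KR_sup n (restrict x {1..n}) = KR_sup n x"
  by (simp add: KR_sup_def discrepancy_def)

lemma integrable_discrepancy:
  assumes f: "1-lipschitz_on UNIV f"
  shows "integrable (PiM {1..n} (\<lambda>_. \<mu>)) (discrepancy n f)"
  unfolding discrepancy_def[abs_def]
  using PiM_component_integral(2)[where I="{1..n}", OF _ lipschitz_1_measurable[OF f]] integrable_lipschitz[OF f]
  by (intro Bochner_Integration.integrable_diff integrable_divide_zero
      Bochner_Integration.integrable_sum P.integrable_const) auto

lemma integrable_KR_sup:
  assumes n: "n \<ge> 1" shows "integrable (PiM {1..n} (\<lambda>_. \<mu>)) (KR_sup n)"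
proof -
  have "integrable (PiM {1..n} (\<lambda>_. \<mu>)) (\<lambda>x. real n * KR_sup n x)"
    by (intro integrable_sum_lipschitz sum_lipschitz_KR_sup n) simp
  then show ?thesis using n by simp
qed

text \<open>Chernoff's bound with parameter \<open>l\<close> for \<open>n\<close> times the dual
  functional, which is sum-Lipschitz with constant 1.\<close>

lemma KR_sup_deviation:
  assumes n: "n \<ge> 1" and l: "l \<ge> 0"
    and L: "\<And>f. 1-lipschitz_on UNIV f \<Longrightarrow>
      (\<integral>\<^sup>+x. ennreal (exp (l * f x)) \<partial>\<mu>) \<le> ennreal (exp (c + l * (\<integral>x. f x \<partial>\<mu>)))"
  shows "measure (PiM {1..n} (\<lambda>_. \<mu>)) {x \<in> space (PiM {1..n} (\<lambda>_. \<mu>)).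
      (\<integral>x. KR_sup n x \<partial>PiM {1..n} (\<lambda>_. \<mu>)) + r \<le> KR_sup n x} \<le> exp (- real n * (l * r - c))"
proof -
  let ?N = "PiM {1..n} (\<lambda>_. \<mu>)"
  define m where "m = (\<integral>x. KR_sup n x \<partial>?N)"
  define S where "S = {x \<in> space ?N. m + r \<le> KR_sup n x}"
  have [measurable]: "KR_sup n \<in> borel_measurable ?N" using integrable_KR_sup[OF n] by auto
  have S[measurable]: "S \<in> sets ?N" unfolding S_def by measurable
  have "ennreal (exp (l * real n * (m + r))) * emeasure ?N S = (\<integral>\<^sup>+x. ennreal (exp (l * real n * (m + r))) * indicator S x \<partial>?N)"
    by (rule nn_integral_cmult_indicator[symmetric]) simp
  also have "\<dots> \<le> (\<integral>\<^sup>+x. ennreal (exp (l * (real n * KR_sup n x))) \<partial>?N)"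
    using l by (intro nn_integral_mono)
      (auto simp: S_def indicator_def mult.assoc intro!: ennreal_leI mult_left_mono)
  also have "\<dots> \<le> ennreal (exp (real n * c + l * (real n * m)))"
    using laplace_tensor[OF _ sum_lipschitz_KR_sup[OF n] L] by (simp add: m_def)
  finally have "exp (l * real n * (m + r)) * measure ?N S \<le> exp (real n * c + l * (real n * m))"
    by (simp add: P.emeasure_eq_measure ennreal_mult[symmetric])
  then have "measure ?N S \<le> exp (real n * c + l * (real n * m)) / exp (l * real n * (m + r))"
    by (simp add: field_simps)
  also have "\<dots> = exp (- real n * (l * r - c))"
    by (simp add: exp_diff[symmetric] algebra_simps)
  finally show ?thesis by (simp add: S_def m_def)
qed

text \<open>Maximal inequality: the exponential of a maximum is at most the sum of the exponentials,
  and Jensen's inequality returns to the mean. The parameter per coordinate is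
  \<open>l / real n\<close> because the discrepancy is an average.\<close>

lemma expectation_max_discrepancy:
  assumes n: "n \<ge> 1" and l: "l > 0" and C: "finite C" "C \<noteq> {}"
    and g: "\<And>k. k \<in> C \<Longrightarrow> 1-lipschitz_on UNIV (g k)"
    and L: "\<And>f. 1-lipschitz_on UNIV f \<Longrightarrow>
      (\<integral>\<^sup>+x. ennreal (exp (l / real n * f x)) \<partial>\<mu>) \<le> ennreal (exp (c + l / real n * (\<integral>x. f x \<partial>\<mu>)))"
  shows "(\<integral>x. (MAX k\<in>C. discrepancy n (g k) x) \<partial>PiM {1..n} (\<lambda>_. \<mu>)) \<le> (ln (real (card C)) + real n * c) / l"
proof -
  let ?N = "PiM {1..n} (\<lambda>_. \<mu>)"
  define Y where "Y k x = discrepancy n (g k) x" for k x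
  define M where "M x = (MAX k\<in>C. Y k x)" for x
  \<comment> \<open>With this value \<open>exp (l * m)\<close> equals \<open>card C\<close> times
    \<open>exp (real n * c)\<close>.\<close>
  define m where "m = (ln (real (card C)) + real n * c) / l"
  have iY: "integrable ?N (Y k)" if "k \<in> C" for k
    unfolding Y_def[abs_def] using integrable_discrepancy[OF g[OF that]] by simp
  then have [measurable]: "Y k \<in> borel_measurable ?N" if "k \<in> C" for k
    using that by auto
  have iM: "integrable ?N M" unfolding M_def by (intro integrable_MAX C iY)
  then have [measurable]: "M \<in> borel_measurable ?N" by auto
  have eY: "(\<integral>\<^sup>+x. ennreal (exp (l * Y k x)) \<partial>?N) \<le> ennreal (exp (real n * c))" if k: "k \<in> C" for k
  proof -
    note gk = g[OF k]
    define b where "b = (\<integral>y. g k y \<partial>\<mu>)"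
    define F where "F x = (\<Sum>i\<in>{1..n}. g k (x i))" for x
    have F: "sum_lipschitz {1..n} F"
      unfolding F_def using lipschitz_1D[OF gk]
      by (intro sum_lipschitzI) (auto simp: sum_subtractf[symmetric] abs_le_iff intro!: sum_mono)
    have [measurable]: "F \<in> borel_measurable ?N"
      using borel_measurable_sum_lipschitz[OF _ F] by measurable
    have IF: "(\<integral>x. F x \<partial>?N) = real n * b"
      unfolding F_def b_def
      using PiM_component_integral[where I="{1..n}", OF _ lipschitz_1_measurable[OF gk]] integrable_lipschitz[OF gk]
      by (subst Bochner_Integration.integral_sum) auto
    have "(\<integral>\<^sup>+x. ennreal (exp (l * Y k x)) \<partial>?N) = (\<integral>\<^sup>+x. ennreal (exp (- (l * b))) * ennreal (exp (l / real n * F x)) \<partial>?N)"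
      by (intro nn_integral_cong)
        (simp add: Y_def discrepancy_def F_def b_def ennreal_mult[symmetric] exp_add[symmetric] algebra_simps)
    also have "\<dots> = ennreal (exp (- (l * b))) * (\<integral>\<^sup>+x. ennreal (exp (l / real n * F x)) \<partial>?N)"
      by (rule nn_integral_cmult) simp
    also have "\<dots> \<le> ennreal (exp (- (l * b))) * ennreal (exp (real n * c + l / real n * (real n * b)))"
      using laplace_tensor[OF _ F L] by (intro mult_left_mono) (simp_all add: IF)
    also have "\<dots> = ennreal (exp (real n * c))"
      using n by (simp add: ennreal_mult[symmetric] exp_add[symmetric])
    finally show ?thesis .
  qed
  have "(\<integral>\<^sup>+x. ennreal (exp (l * M x)) \<partial>?N) \<le> (\<integral>\<^sup>+x. (\<Sum>k\<in>C. ennreal (exp (l * Y k x))) \<partial>?N)"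
  proof (rule nn_integral_mono)
    fix x
    have "M x \<in> (\<lambda>k. Y k x) ` C" unfolding M_def using C by (intro Max_in) auto
    then obtain k where "k \<in> C" "M x = Y k x" by auto
    then show "ennreal (exp (l * M x)) \<le> (\<Sum>k\<in>C. ennreal (exp (l * Y k x)))"
      using member_le_sum[of k C "\<lambda>k. ennreal (exp (l * Y k x))"] C by simp
  qed
  also have "\<dots> = (\<Sum>k\<in>C. \<integral>\<^sup>+x. ennreal (exp (l * Y k x)) \<partial>?N)"
    by (rule nn_integral_sum) auto
  also have "\<dots> \<le> (\<Sum>k\<in>C. ennreal (exp (real n * c)))" by (intro sum_mono eY)
  also have "\<dots> = ennreal (exp (l * m))"
    using l C by (simp add: m_def exp_add ennreal_of_nat_eq_real_of_nat ennreal_mult card_gt_0_iff)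
  finally have eM: "(\<integral>\<^sup>+x. ennreal (exp (l * M x)) \<partial>?N) \<le> ennreal (exp (l * m))" .
  have ie: "integrable ?N (\<lambda>x. exp (l * M x))"
    by (rule integrableI_nonneg) (use eM in \<open>auto intro: le_less_trans\<close>)
  have ME: "(\<integral>x. exp (l * M x) \<partial>?N) \<le> exp (l * m)"
    using eM ie by (subst (asm) nn_integral_eq_integral) auto
  \<comment> \<open>Jensen's inequality in the form needed: the exponential lies above its tangent
    at \<open>l * m\<close>.\<close>
  have "(\<integral>x. exp (l * m) * (1 + l * (M x - m)) \<partial>?N) \<le> (\<integral>x. exp (l * M x) \<partial>?N)"
  proof (rule integral_mono)
    fix x
    have "exp (l * m) * (1 + l * (M x - m)) \<le> exp (l * m) * exp (l * (M x - m))"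
      by (intro mult_left_mono) auto
    then show "exp (l * m) * (1 + l * (M x - m)) \<le> exp (l * M x)"
      by (simp add: exp_add[symmetric] algebra_simps)
  qed (use iM ie in auto)
  also have "(\<integral>x. exp (l * m) * (1 + l * (M x - m)) \<partial>?N) = exp (l * m) * (1 + l * ((\<integral>x. M x \<partial>?N) - m))"
    using iM by (simp add: prob_space.prob_space[OF P.prob_space_axioms])
  finally have "exp (l * m) * (1 + l * ((\<integral>x. M x \<partial>?N) - m)) \<le> exp (l * m) * 1" using ME by linarith
  then have "1 + l * ((\<integral>x. M x \<partial>?N) - m) \<le> 1" by (simp only: mult_le_cancel_left_pos exp_gt_zero)
  then have "(\<integral>x. M x \<partial>?N) \<le> m" using l by (simp add: mult_le_0_iff)
  then show ?thesis by (simp add: M_def Y_def m_def)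
qed

text \<open>Each test function is replaced by an extended centre of the covering. The error is paid
  under both the empirical measure and \<mu>, each time \<delta> on \<open>K\<close> and twice the
  distance to \<open>x\<^sub>0\<close> off \<open>K\<close>; in expectation this totals
  \<open>2 * \<delta> + 4 * \<epsilon>\<close>.\<close>

lemma expectation_KR_sup:
  assumes n: "n \<ge> 1" and l: "l > 0" and K: "compact K" "x\<^sub>0 \<in> K" and \<delta>: "\<delta> > 0"
    and tail: "(\<integral>x. indicator (- K) x * dist x x\<^sub>0 \<partial>\<mu>) \<le> \<epsilon>"
    and L: "\<And>f. 1-lipschitz_on UNIV f \<Longrightarrow>
      (\<integral>\<^sup>+x. ennreal (exp (l / real n * f x)) \<partial>\<mu>) \<le> ennreal (exp (c + l / real n * (\<integral>x. f x \<partial>\<mu>)))"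
  shows "(\<integral>x. KR_sup n x \<partial>PiM {1..n} (\<lambda>_. \<mu>)) \<le> 2 * \<delta> + 4 * \<epsilon> +
    (ln (real (covering_number (lip_functions K x\<^sub>0) (uniform_dist K) \<delta>)) + real n * c) / l"
proof -
  let ?N = "PiM {1..n} (\<lambda>_. \<mu>)"
  let ?A = "lip_functions K x\<^sub>0"
  obtain C where C: "C \<subseteq> ?A" "finite C" "card C = covering_number ?A (uniform_dist K) \<delta>"
    "\<And>f. f \<in> ?A \<Longrightarrow> \<exists>c\<in>C. uniform_dist K c f \<le> \<delta>"
    using covering_number_obtain[OF lip_functions_totally_bounded[OF K \<delta>]] by blast
  \<comment> \<open>The zero function must be covered, so \<open>C\<close> is nonempty and the
    maximum over it is meaningful.\<close>
  have "restrict (\<lambda>_. 0) K \<in> ?A" using K(2) by (auto simp: lip_functions_def lipschitz_on_def)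
  then have ne: "C \<noteq> {}" using C(4) by blast
  have "\<exists>f. 1-lipschitz_on UNIV f \<and> (\<forall>x\<in>K. f x = k x)" if "k \<in> C" for k
  proof -
    have "1-lipschitz_on K k" using that C(1) lip_functionsD(3) by blast
    moreover have "K \<noteq> {}" using K by auto
    ultimately show ?thesis by (metis lipschitz_1_extension)
  qed
  then obtain g where g: "\<And>k. k \<in> C \<Longrightarrow> 1-lipschitz_on UNIV (g k)" "\<And>k x. k \<in> C \<Longrightarrow> x \<in> K \<Longrightarrow> g k x = k x"
    by metis
  define h where "h x = indicator (- K) x * dist x x\<^sub>0" for x
  have [measurable]: "K \<in> sets borel" using K(1) by (simp add: compact_imp_closed)
  have [measurable]: "h \<in> borel_measurable borel" unfolding h_def by measurable
  have ih: "integrable \<mu> h"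
    by (rule Bochner_Integration.integrable_bound[OF integrable_dist0]) (auto simp: h_def indicator_def)
  define H where "H x = (\<Sum>i\<in>{1..n}. h (x i)) / real n" for x
  have ihi: "integrable ?N (\<lambda>x. h (x i))" "(\<integral>x. h (x i) \<partial>?N) = (\<integral>x. h x \<partial>\<mu>)" if "i \<in> {1..n}" for i
    using PiM_component_integral[of i "{1..n}" h] ih that by auto
  have iH: "integrable ?N H"
    unfolding H_def by (intro integrable_divide_zero Bochner_Integration.integrable_sum ihi)
  have EH: "(\<integral>x. H x \<partial>?N) = (\<integral>x. h x \<partial>\<mu>)"
    unfolding H_def using ihi n by simp
  define M where "M x = (MAX k\<in>C. discrepancy n (g k) x)" for x
  have iM: "integrable ?N M"
    unfolding M_def by (intro integrable_MAX C ne integrable_discrepancy g)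
  have pt: "KR_sup n x \<le> M x + (2 * \<delta> + 2 * H x + 2 * (\<integral>x. h x \<partial>\<mu>))" for x
  proof (rule KR_sup_least)
    fix f :: "'a \<Rightarrow> real" assume f: "1-lipschitz_on UNIV f"
    define f' where "f' x = f x - f x\<^sub>0" for x
    have f': "1-lipschitz_on UNIV f'"
      using lipschitz_1D[OF f] by (intro lipschitz_1I) (auto simp: f'_def abs_le_iff)
    have fA: "restrict f' K \<in> ?A"
      using lipschitz_on_subset[OF f', of K] K(2)
      by (auto simp: lip_functions_def f'_def cong: lipschitz_on_cong)
    then obtain k where k: "k \<in> C" "uniform_dist K k (restrict f' K) \<le> \<delta>" using C(4) by blast
    have kA: "k \<in> ?A" using k C by auto
    have gk: "g k x\<^sub>0 = 0" using g(2)[OF k(1) K(2)] lip_functionsD(2)[OF kA] by simp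
    have diff: "\<bar>f' y - g k y\<bar> \<le> \<delta> + 2 * h y" for y
    proof (cases "y \<in> K")
      case True
      then show ?thesis
        using lip_functions_uniform_distD[OF K kA fA k(2) True] g(2)[OF k(1) True] by (simp add: h_def)
    next
      case False
      then show ?thesis
        using lipschitz_1D[OF f', of y x\<^sub>0] lipschitz_1D[OF g(1)[OF k(1)], of y x\<^sub>0] gk \<delta>
        by (simp add: h_def f'_def)
    qed
    have "discrepancy n f' x - discrepancy n (g k) x
        = (\<Sum>i\<in>{1..n}. f' (x i) - g k (x i)) / real n + (\<integral>y. g k y - f' y \<partial>\<mu>)"
      using integrable_lipschitz[OF f'] integrable_lipschitz[OF g(1)[OF k(1)]]
      by (simp add: discrepancy_def sum_subtractf diff_divide_distrib)
    also have "(\<Sum>i\<in>{1..n}. f' (x i) - g k (x i)) / real n \<le> (\<Sum>i\<in>{1..n}. \<delta> + 2 * h (x i)) / real n"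
      using diff by (intro divide_right_mono sum_mono) (auto simp: abs_le_iff)
    also have "\<dots> = \<delta> + 2 * H x"
      using n by (simp add: H_def sum.distrib sum_distrib_left[symmetric] add_divide_distrib)
    also have "(\<integral>y. g k y - f' y \<partial>\<mu>) \<le> (\<integral>y. \<delta> + 2 * h y \<partial>\<mu>)"
      using integrable_lipschitz[OF f'] integrable_lipschitz[OF g(1)[OF k(1)]] ih diff
      by (intro integral_mono) (auto simp: abs_le_iff)
    also have "\<dots> = \<delta> + 2 * (\<integral>y. h y \<partial>\<mu>)" using ih by simp
    finally have "discrepancy n f' x \<le> discrepancy n (g k) x + (2 * \<delta> + 2 * H x + 2 * (\<integral>x. h x \<partial>\<mu>))"
      by simp
    also have "discrepancy n (g k) x \<le> M x" unfolding M_def using C k by (intro Max_ge) auto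
    also have "discrepancy n f' x = discrepancy n f x"
      unfolding f'_def by (rule discrepancy_minus_const[OF n f])
    finally show "discrepancy n f x \<le> M x + (2 * \<delta> + 2 * H x + 2 * (\<integral>x. h x \<partial>\<mu>))" by simp
  qed
  have "(\<integral>x. KR_sup n x \<partial>?N) \<le> (\<integral>x. M x + (2 * \<delta> + 2 * H x + 2 * (\<integral>x. h x \<partial>\<mu>)) \<partial>?N)"
    using iM iH by (intro integral_mono integrable_KR_sup n pt) auto
  also have "\<dots> = (\<integral>x. M x \<partial>?N) + (2 * \<delta> + 4 * (\<integral>x. h x \<partial>\<mu>))"
    using iM iH by (simp add: EH prob_space.prob_space[OF P.prob_space_axioms])
  also have "\<dots> \<le> (ln (real (card C)) + real n * c) / l + (2 * \<delta> + 4 * \<epsilon>)"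
    using expectation_max_discrepancy[where g=g, OF n l C(2) ne g(1) L] tail by (simp add: M_def h_def)
  finally show ?thesis by (simp add: C(3))
qed

end

section \<open>The deviation bound\<close>

text \<open>The slope is the infimum of the right difference quotients at \<open>s\<close>, an
  interior point of the half-line. At this \<open>l\<close> the conjugate is attained at
  \<open>s\<close>, which makes the Chernoff exponent equal to \<open>\<alpha> s\<close>.\<close>

lemma convex_mono_supporting_line:
  fixes \<alpha> :: "real \<Rightarrow> real"
  assumes cvx: "convex_on {0..} \<alpha>" and mono: "mono_on {0..} \<alpha>" and s: "s > 0"
  obtains l where "l \<ge> 0" "\<And>u. u \<ge> 0 \<Longrightarrow> \<alpha> s + l * (u - s) \<le> \<alpha> u"
proof -
  define l where "l = Inf ((\<lambda>t. (\<alpha> s - \<alpha> t) / (s - t)) ` ({s<..} \<inter> {0..}))"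
  have line: "\<alpha> s + l * (u - s) \<le> \<alpha> u" if "u \<ge> 0" for u
    using convex_le_Inf_differential[OF cvx, of s u] s that by (simp add: l_def)
  have "l \<ge> 0" unfolding l_def
  proof (rule cINF_greatest)
    have "s + 1 \<in> {s<..} \<inter> {0..}" using s by simp
    then show "{s<..} \<inter> {0..} \<noteq> {}" by blast
    fix u assume u: "u \<in> {s<..} \<inter> {0..}"
    then have "\<alpha> s \<le> \<alpha> u" using s mono by (auto simp: mono_on_def)
    then show "0 \<le> (\<alpha> s - \<alpha> u) / (s - u)" using u by (simp add: divide_nonpos_neg)
  qed
  then show ?thesis using that line by blast
qed

lemma mono_conj_upper: "u \<ge> 0 \<Longrightarrow> mono_conj \<alpha> l \<le> ereal c \<Longrightarrow> l * u - \<alpha> u \<le> c"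
  unfolding mono_conj_def by (auto simp: SUP_le_iff)

lemma mono_conj_nonneg: "\<alpha> 0 = 0 \<Longrightarrow> 0 \<le> mono_conj \<alpha> l"
  unfolding mono_conj_def by (rule SUP_upper2[of 0]) (auto simp: zero_ereal_def)

theorem theorem2p2:
  fixes \<mu> :: "'a::polish_space measure"
    and x\<^sub>0 :: 'a
    and \<alpha> :: "real \<Rightarrow> real"
    and P :: "'b measure"
    and X :: "nat \<Rightarrow> 'b \<Rightarrow> 'a"
    and n :: nat
    and t a :: real
    and K :: "'a set"
  assumes \<mu>: "\<mu> \<in> borel_probs"
    and \<alpha>_convex: "convex_on {0..} \<alpha>"
    and \<alpha>_mono: "mono_on {0..} \<alpha>"
    and \<alpha>_left_cont: "\<forall>s>0. continuous (at_left s) \<alpha>"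
    and \<alpha>_zero: "\<alpha> 0 = 0"
    and transport: "transport_ineq \<alpha> \<mu>"
    and P: "prob_space P"
    and n: "n \<ge> 1"
    and indep: "prob_space.indep_vars P (\<lambda>_. borel) X {1..n}"
    and law: "\<forall>i\<in>{1..n}. distr P borel (X i) = \<mu>"
    and t: "t > 0"
    and a: "a > 0"
    and exp_moment: "(\<integral>\<^sup>+ x. ennreal (exp (a * dist x\<^sub>0 x)) \<partial>\<mu>) \<le> 2"
    and K: "compact K" "x\<^sub>0 \<in> K"
    and K_compl: "emeasure \<mu> (- K) \<le>
      inverse (ennreal (32 / (a * t) * ln (32 / (a * t)) - 32 / (a * t) + 1))"
  shows "measure P {\<omega> \<in> space P. ennreal t \<le> W1 (empirical_measure n (\<lambda>i. X i \<omega>)) \<mu>} \<le>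
    exp (- real n * real_of_ereal (extend \<alpha>
      (ereal (t / 2) - Gamma_term \<alpha> (covering_number (lip_functions K x\<^sub>0) (uniform_dist K) (t / 8)) n)))"
proof -
  interpret Pr: prob_space P by fact
  have p\<mu>: "prob_space \<mu>" and sets\<mu>: "sets \<mu> = sets borel"
    using \<mu> by (auto simp: space_prob_algebra)
  have mK: "- K \<in> sets borel" using K(1) by (simp add: compact_imp_closed)
  note tail = exp_moment_tail[OF p\<mu> sets\<mu> t a exp_moment mK K_compl]
  interpret borel_prob_first_moment \<mu> x\<^sub>0
    by (intro borel_prob_first_moment.intro p\<mu> borel_prob_first_moment_axioms.intro sets\<mu> tail(1))
  let ?N = "PiM {1..n} (\<lambda>_. \<mu>)"
  have L: "(\<integral>\<^sup>+x. ennreal (exp (l * f x)) \<partial>\<mu>) \<le> ennreal (exp (c + l * (\<integral>x. f x \<partial>\<mu>)))"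
    if "l \<ge> 0" "\<And>u. u \<ge> 0 \<Longrightarrow> l * u - \<alpha> u \<le> c" "1-lipschitz_on UNIV f" for l c f
    by (rule transport_laplace[OF \<mu> transport \<alpha>_mono that(3) integrable_lipschitz[OF that(3)] that(1,2)])
  define N where "N = covering_number (lip_functions K x\<^sub>0) (uniform_dist K) (t / 8)"
  define \<Gamma> where "\<Gamma> = Gamma_term \<alpha> N n"
  define m where "m = (\<integral>x. KR_sup n x \<partial>?N)"
  \<comment> \<open>The expectation bound holds for every \<open>l\<close>. With \<delta> equal to
    \<open>t / 8\<close> and tail bound \<open>t / 16\<close>, the approximation errors
    \<open>2 * (t / 8) + 4 * (t / 16)\<close> amount to \<open>t / 2\<close>.\<close>
  have \<Gamma>: "ereal (m - t / 2) \<le> \<Gamma>"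
    unfolding \<Gamma>_def Gamma_term_def
  proof (rule INF_greatest)
    fix l :: real assume "l \<in> {0<..}"
    then have l: "l > 0" by simp
    show "ereal (m - t / 2) \<le> ereal (1 / l) * (ereal (ln (real N)) + ereal (real n) * mono_conj \<alpha> (l / real n))"
    proof (cases "mono_conj \<alpha> (l / real n)")
      case (real c)
      have "m \<le> 2 * (t / 8) + 4 * (t / 16) + (ln (real N) + real n * c) / l"
        unfolding m_def N_def
        using l t real by (intro expectation_KR_sup[OF n l K _ tail(2)] L mono_conj_upper) auto
      then show ?thesis using real l by (simp add: field_simps)
    next
      case PInf
      then show ?thesis using l n by simp
    next
      case MInf
      then show ?thesis using mono_conj_nonneg[of \<alpha> "l / real n"] \<alpha>_zero by simp
    qed
  qed
  let ?S = "{\<omega> \<in> space P. ennreal t \<le> W1 (empirical_measure n (\<lambda>i. X i \<omega>)) \<mu>}"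
  show ?thesis
  \<comment> \<open>If the exponent vanishes, the bound is 1 and trivial. This covers negative
    arguments, including the case of infinite \<Gamma>.\<close>
  proof (cases "extend \<alpha> (ereal (t / 2) - \<Gamma>) = 0")
    case True
    then show ?thesis by (simp add: \<Gamma>_def N_def)
  next
    case False
    then have nn: "0 \<le> ereal (t / 2) - \<Gamma>" by (auto simp: extend_def not_less[symmetric])
    \<comment> \<open>A nonnegative argument excludes \<Gamma> being infinite; the lower bound
      \<open>m - t / 2\<close> excludes minus infinity.\<close>
    with \<Gamma> obtain \<gamma> where \<gamma>: "\<Gamma> = ereal \<gamma>" by (cases \<Gamma>) auto
    define s where "s = t / 2 - \<gamma>"
    have s0: "s \<ge> 0" using nn by (simp add: \<gamma> s_def)
    have ext: "extend \<alpha> (ereal (t / 2) - \<Gamma>) = ereal (\<alpha> s)"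
      using s0 by (simp add: extend_def \<gamma> s_def)
    have s: "s > 0" using False s0 \<alpha>_zero unfolding ext by (cases "s = 0") auto
    obtain l where l: "l \<ge> 0" "\<And>u. u \<ge> 0 \<Longrightarrow> \<alpha> s + l * (u - s) \<le> \<alpha> u"
      using convex_mono_supporting_line[OF \<alpha>_convex \<alpha>_mono s] by blast
    have ms: "m + s \<le> t" using \<Gamma> by (simp add: \<gamma> s_def)
    have X: "Pr.random_variable borel (X i)" if "i \<in> {1..n}" for i
      using indep that by (simp add: Pr.indep_vars_def)
    have ne: "{1..n} \<noteq> {}" using n by auto
    have "distr P (PiM {1..n} (\<lambda>_. borel)) (\<lambda>\<omega>. \<lambda>i\<in>{1..n}. X i \<omega>) = PiM {1..n} (\<lambda>i. distr P borel (X i))"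
      using Pr.indep_vars_iff_distr_eq_PiM'[where X=X and M'="\<lambda>_. borel", OF ne X] indep by blast
    also have "\<dots> = ?N" using law by (intro PiM_cong) auto
    finally have D: "distr P (PiM {1..n} (\<lambda>_. borel)) (\<lambda>\<omega>. \<lambda>i\<in>{1..n}. X i \<omega>) = ?N" .
    have XM: "(\<lambda>\<omega>. \<lambda>i\<in>{1..n}. X i \<omega>) \<in> measurable P (PiM {1..n} (\<lambda>_. borel))"
      by (intro measurable_restrict X)
    define B where "B = {x \<in> space ?N. m + s \<le> KR_sup n x}"
    have [measurable]: "KR_sup n \<in> borel_measurable ?N" using integrable_KR_sup[OF n] by auto
    have BN: "B \<in> sets ?N" unfolding B_def by measurable
    then have BM: "B \<in> sets (PiM {1..n} (\<lambda>_. borel))" using sets_PiM_mu by blast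
    define T where "T = (\<lambda>\<omega>. \<lambda>i\<in>{1..n}. X i \<omega>) -` B \<inter> space P"
    have T: "T \<in> sets P" unfolding T_def by (rule measurable_sets[OF XM BM])
    \<comment> \<open>Only the enclosing event \<open>T\<close> has to be measurable for
      monotonicity of \<open>measure\<close>.\<close>
    have "?S \<subseteq> T"
    proof
      fix \<omega> assume \<omega>: "\<omega> \<in> ?S"
      then have "ennreal t \<le> ennreal (KR_sup n (\<lambda>i. X i \<omega>))"
        using W1_le_KR_sup[OF n] order_trans by blast
      then have "t \<le> KR_sup n (\<lambda>i\<in>{1..n}. X i \<omega>)"
        using t by (simp add: KR_sup_restrict ennreal_le_iff2)
      then show "\<omega> \<in> T" using \<omega> ms by (auto simp: T_def B_def space_PiM)
    qed
    then have "measure P ?S \<le> measure P T"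
      using T by (rule Pr.finite_measure_mono)
    also have "\<dots> = measure ?N B"
      unfolding T_def by (subst D[symmetric]) (simp add: measure_distr[OF XM BM])
    \<comment> \<open>The supporting line says that \<open>l * s - \<alpha> s\<close> bounds the
      conjugate at \<open>l\<close>, so it serves as the constant \<open>c\<close>.\<close>
    also have "\<dots> \<le> exp (- real n * (l * s - (l * s - \<alpha> s)))"
      unfolding B_def m_def
      by (rule KR_sup_deviation[OF n l(1)], rule L[OF l(1)]) (use l(2) in \<open>auto simp: algebra_simps\<close>)
    finally show ?thesis by (simp add: ext[unfolded \<Gamma>_def N_def])
  qed
qed

end
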